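(* Consider the half-duplex single-relay fading channel described in the context. The diversity-multiplexing tradeoff achieved by the single-relay dynamic decode-and-forward (DDF) protocol is $$d(r)=\begin{cases}2(1-r), & 0\le r\le \tfrac12,\\[2pt] \dfrac{1-r}{r}, & \tfrac12\le r\le 1.\end{cases}$$
   Context: Channel. All channels are flat, Rayleigh-fading and quasi-static: the channel gains $g_1$ (source-destination), $g_2$ (relay-destination) and $h$ (source-relay) are mutually independent zero-mean unit-variance complex Gaussian random variables, constant over a codeword of $l$ symbol-intervals (which spans a whole coherence interval). Noises are zero-mean, mutually independent, circularly-symmetric white complex Gaussian, of variance $\sigma_w^2$ at the relay and $\sigma_v^2$ at the destination, with $c=\sigma_v^2/\sigma_w^2$ a fixed constant. All nodes have the same power constraint (average energy $E$ available per transmitted symbol), have a single antenna, and operate synchronously; $\rho=E/\sigma_v^2$ is the signal-to-noise ratio. The channel gain of a link is known only at its receiving node; there is no feedback to transmitters. Half-duplex: a node cannot transmit and receive at the same time. Single-relay DDF protocol. The source transmits data at rate $R$ bits per channel use during all $l$ symbol-intervals, using a random Gaussian code-book. The relay listens to the source until the mutual information between its received signal and the source signal exceeds $lR$; the number of symbol-intervals during which it listens is $$l'=\min\left\{l,\left\lceil \frac{lR}{\log_2(1+|h|^2c\rho)}\right\rceil\right\}.$$ It then decodes the message, re-encodes it using an independent Gaussian code-book, and transmits the result during the rest of the codeword (if $l'=l$ the relay does not contribute to the transmission). With source symbols $x_k$, relay symbols $\tilde x_k$ and destination noise $v_k$, the destination receives $$y_k=g_1x_k+v_k\ (1\le k\le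 l'),\qquad y_k=g_1x_k+g_2\tilde x_k+v_k\ (l'<k\le l).$$ The destination knows $g_1$, $g_2$ and $l'$, and uses maximum-likelihood (ML) decoding. Code-lengths $l$ are assumed asymptotically large. Diversity and multiplexing. With rate $R(\rho)$ and ML error probability $P_E(\rho)$ at the destination, the multiplexing gain is $r=\lim_{\rho\to\infty}R(\rho)/\log\rho$ and the diversity gain is $d=-\lim_{\rho\to\infty}\log P_E(\rho)/\log\rho$; $d(r)$ is the diversity gain achieved at multiplexing gain $r$. Logarithms are base 2.
   Formalization: The rate R(ρ) is required to stay above some positive constant for large ρ; this is automatic for r>0, but at r=0 the claim fails without it (R=0 gives zero error probability, R=1/ρ gives diversity 4 instead of 2). *)

theory Defs
  imports "HOL-Probability.Probability"
begin

text \<open>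
  Density and law of a zero-mean circularly-symmetric complex Gaussian variable \<open>Z\<close> with
  \<open>E |Z|\<^sup>2 = s\<close>, i.e. real and imaginary parts are independent with variance \<open>s / 2\<close> each.
\<close>

definition cgauss_density :: "real \<Rightarrow> complex \<Rightarrow> real" where
  "cgauss_density s z = exp (- (cmod z)\<^sup>2 / s) / (pi * s)"

definition cgauss :: "real \<Rightarrow> complex measure" where
  "cgauss s = density lborel (\<lambda>z. ennreal (cgauss_density s z))"

text \<open>
  The rate \<open>R\<close> is in bits per channel use, so a codeword of \<open>l\<close> symbols carries one of
  \<open>2 powr (l * R)\<close> messages, rounded up to an integer.
\<close>

definition num_messages :: "real \<Rightarrow> nat \<Rightarrow> nat" where
  "num_messages R l = nat \<lceil>2 powr (real l * R)\<rceil>"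

text \<open>
  The number \<open>l'\<close> of symbol-intervals during which the relay listens. A relay with \<open>h = 0\<close> never
  gathers any information; this case is separate because division by \<open>log 2 1 = 0\<close> yields \<open>0\<close>.
\<close>

definition listening_time :: "real \<Rightarrow> real \<Rightarrow> real \<Rightarrow> nat \<Rightarrow> complex \<Rightarrow> nat" where
  "listening_time c \<rho> R l h =
    (if h = 0 then l
     else min l (nat \<lceil>real l * R / log 2 (1 + (cmod h)\<^sup>2 * c * \<rho>)\<rceil>))"

text \<open>
  In the following, \<open>x (m, k)\<close> and \<open>xr (m, k)\<close> are the \<open>k\<close>-th symbols of the source and relay
  codewords of message \<open>m\<close>, and \<open>l'\<close> is the listening time. The relay is silent up to time \<open>l'\<close>
  and afterwards transmits its own codeword of the message the source is sending (that is,
  the message has been decoded at the relay); if \<open>l' = l\<close> it never transmits.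
\<close>

definition ddf_signal ::
  "complex \<Rightarrow> complex \<Rightarrow> nat \<Rightarrow> (nat \<times> nat \<Rightarrow> complex) \<Rightarrow> (nat \<times> nat \<Rightarrow> complex)
    \<Rightarrow> nat \<Rightarrow> nat \<Rightarrow> complex" where
  "ddf_signal g1 g2 l' x xr m k =
    g1 * x (m, k) + (if l' < k then g2 * xr (m, k) else 0)"

text \<open>
  Conditional density of the block \<open>y 1, \<dots>, y l\<close> received at the destination (noise variance
  \<open>sv\<close>), given the message \<open>m\<close>, the gains \<open>g1\<close>, \<open>g2\<close>, the listening time and the code-books.
\<close>

definition ddf_likelihood ::
  "real \<Rightarrow> nat \<Rightarrow> complex \<Rightarrow> complex \<Rightarrow> nat \<Rightarrow> (nat \<times> nat \<Rightarrow> complex) \<Rightarrow> (nat \<times> nat \<Rightarrow> complex)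
    \<Rightarrow> (nat \<Rightarrow> complex) \<Rightarrow> nat \<Rightarrow> real" where
  "ddf_likelihood sv l g1 g2 l' x xr y m =
    (\<Prod>k\<in>{1..l}. cgauss_density sv (y k - ddf_signal g1 g2 l' x xr m k))"

text \<open>Ties are resolved in favour of the least message index.\<close>

definition ml_decode :: "(nat \<Rightarrow> real) \<Rightarrow> nat \<Rightarrow> nat" where
  "ml_decode L N = (LEAST m. is_arg_max L (\<lambda>m. m < N) m)"

text \<open>
  All the randomness for block length \<open>l\<close>: gains \<open>g1\<close>, \<open>g2\<close>, \<open>h\<close>; the two Gaussian code-books,
  with average energy \<open>E\<close> per symbol; the destination noise; a uniformly distributed message.
  The relay noise enters the model through the listening time only.
\<close>

definition ddf_space ::
  "real \<Rightarrow> real \<Rightarrow> nat \<Rightarrow> nat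
    \<Rightarrow> ((complex \<times> complex \<times> complex)
        \<times> ((nat \<times> nat \<Rightarrow> complex) \<times> (nat \<times> nat \<Rightarrow> complex))
        \<times> (nat \<Rightarrow> complex) \<times> nat) measure" where
  "ddf_space sv E N l =
    (cgauss 1 \<Otimes>\<^sub>M cgauss 1 \<Otimes>\<^sub>M cgauss 1)
    \<Otimes>\<^sub>M (PiM ({..<N} \<times> {1..l}) (\<lambda>_. cgauss E) \<Otimes>\<^sub>M PiM ({..<N} \<times> {1..l}) (\<lambda>_. cgauss E))
    \<Otimes>\<^sub>M PiM {1..l} (\<lambda>_. cgauss sv)
    \<Otimes>\<^sub>M measure_pmf (pmf_of_set {..<N})"

text \<open>
  ML error probability at the destination (averaged over the random code-books) for block length
  \<open>l\<close>, rate \<open>R\<close> and signal-to-noise ratio \<open>\<rho> = E / sv\<close>, where \<open>sw\<close> and \<open>sv\<close> are the noise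
  variances at the relay and at the destination.
\<close>

definition ddf_error_prob :: "real \<Rightarrow> real \<Rightarrow> real \<Rightarrow> real \<Rightarrow> nat \<Rightarrow> real" where
  "ddf_error_prob sw sv \<rho> R l =
    (let N = num_messages R l; S = ddf_space sv (\<rho> * sv) N l in
     measure S {((g1, g2, h), (x, xr), v, w) \<in> space S.
       let l' = listening_time (sv / sw) \<rho> R l h;
           y = (\<lambda>k. ddf_signal g1 g2 l' x xr w k + v k)
       in ml_decode (ddf_likelihood sv l g1 g2 l' x xr y) N \<noteq> w})"

definition has_multiplexing_gain :: "(real \<Rightarrow> real) \<Rightarrow> real \<Rightarrow> bool" where
  "has_multiplexing_gain R r \<longleftrightarrow> ((\<lambda>\<rho>. R \<rho> / log 2 \<rho>) \<longlongrightarrow> r) at_top"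

text \<open>Positivity is required because \<open>log 2 0 = 0\<close>.\<close>

definition has_diversity_gain :: "(real \<Rightarrow> real) \<Rightarrow> real \<Rightarrow> bool" where
  "has_diversity_gain P d \<longleftrightarrow>
    (\<forall>\<^sub>F \<rho> in at_top. P \<rho> > 0) \<and> ((\<lambda>\<rho>. - (log 2 (P \<rho>) / log 2 \<rho>)) \<longlongrightarrow> d) at_top"

text \<open>
  Code-lengths are asymptotically large: the error probability at a given signal-to-noise ratio
  is the limit for \<open>l \<rightarrow> \<infinity>\<close>, whose existence is part of the claim.
\<close>

definition ddf_achieves :: "real \<Rightarrow> real \<Rightarrow> (real \<Rightarrow> real) \<Rightarrow> real \<Rightarrow> bool" where
  "ddf_achieves sw sv R d \<longleftrightarrow>
    (\<exists>P. (\<forall>\<^sub>F \<rho> in at_top. (\<lambda>l. ddf_error_prob sw sv \<rho> (R \<rho>) l) \<longlonglongrightarrow> P \<rho>)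
       \<and> has_diversity_gain P d)"

end

theory Submission
  imports Defs "HOL-Real_Asymp.Real_Asymp"
begin

text \<open>
  Fix the gains. With the random Gaussian code-books, the code-book averages of the output density
  given one message, and of the product of the densities given two messages, are \<open>q\<close> and \<open>q\<^sup>2\<close>,
  where \<open>q\<close> is a product of Gaussian densities. Comparing the likelihood of the transmitted message
  with a threshold \<open>T q\<close> bounds the error probability from above by the union bound, and the
  probability of correct decoding from above because decision regions are disjoint. The logarithm of
  the likelihood ratio is a constant plus a difference of two sums of squared moduli of independent
  Gaussians, which concentrate by Chernoff's inequality. As \<open>l \<rightarrow> \<infinity>\<close>, the conditional error probability
  therefore tends to 1 or 0, according to whether the mutual information per symbol
  \<open>f log (1 + |g1|\<^sup>2 \<rho>) + (1 - f) log (1 + (|g1|\<^sup>2 + |g2|\<^sup>2) \<rho>)\<close> is below or above the rate, where \<open>f\<close>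
  is the limit of \<open>l' / l\<close>. By dominated convergence the error probability tends to the outage
  probability.

  For the exponent of the latter, let \<open>\<alpha>, \<beta>, \<gamma>\<close> be the exponents in \<open>\<rho>\<close> of the three links,
  truncated at 1. Outage forces \<open>3 - \<alpha> - \<beta> - \<gamma> \<ge> d (r)\<close>, and \<open>\<rho> powr (1 - \<alpha>) \<le> 1 + 1 / |g1|\<^sup>2\<close> has finite
  moments of all orders \<open>s < 1\<close>, so that Markov's inequality bounds the outage probability by
  \<open>K \<rho> powr (- s d)\<close>. Conversely, outage occurs if both destination links are weak, and for
  \<open>r > 1/2\<close> if only the direct link is weak while the two others have bounded gain.
\<close>

section \<open>Complex Gaussian measures\<close>

lemma cgauss_density_nonneg [simp]: "0 < s \<Longrightarrow> 0 \<le> cgauss_density s z"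
  by (simp add: cgauss_density_def)

lemma cgauss_density_pos: "0 < s \<Longrightarrow> 0 < cgauss_density s z"
  by (simp add: cgauss_density_def)

lemma borel_measurable_cgauss_density [measurable]: "cgauss_density s \<in> borel_measurable borel"
  unfolding cgauss_density_def by measurable

lemma space_cgauss [simp]: "space (cgauss s) = UNIV"
  by (simp add: cgauss_def)

lemma sets_cgauss [simp, measurable_cong]: "sets (cgauss s) = sets borel"
  by (simp add: cgauss_def)

lemma nn_integral_cgauss:
  assumes [measurable]: "f \<in> borel_measurable borel"
  shows "(\<integral>\<^sup>+z. f z \<partial>cgauss s) = (\<integral>\<^sup>+z. ennreal (cgauss_density s z) * f z \<partial>lborel)"
  unfolding cgauss_def by (subst nn_integral_density) auto

lemma nn_integral_gauss_real:
  assumes "0 < s"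
  shows "(\<integral>\<^sup>+x. ennreal (exp (- x\<^sup>2 / s) / sqrt (pi * s)) \<partial>lborel) = 1"
proof -
  have pos: "0 < sqrt (s / 2)"
    using assms by simp
  have dens: "normal_density 0 (sqrt (s / 2)) x = exp (- x\<^sup>2 / s) / sqrt (pi * s)" for x
    using assms by (simp add: normal_density_def mult.commute)
  interpret prob_space "density lborel (normal_density 0 (sqrt (s / 2)))"
    using pos by (rule prob_space_normal_density)
  show ?thesis
    using emeasure_space_1 by (simp add: emeasure_density dens)
qed

lemma nn_integral_lborel_shift:
  fixes c :: "'a::euclidean_space"
  assumes [measurable]: "f \<in> borel_measurable borel"
  shows "(\<integral>\<^sup>+x. f (x - c) \<partial>lborel) = (\<integral>\<^sup>+x. f x \<partial>lborel)"
proof -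
  have "(\<integral>\<^sup>+x. f x \<partial>lborel) = (\<integral>\<^sup>+x. f x \<partial>distr lborel borel ((+) (- c)))"
    by (simp add: lborel_distr_plus)
  also have "\<dots> = (\<integral>\<^sup>+x. f (x - c) \<partial>lborel)"
    by (subst nn_integral_distr) (auto simp: add.commute)
  finally show ?thesis ..
qed

text \<open>The density factors into real normal densities of variance \<open>s / 2\<close> for the
  real and the imaginary part. The shift \<open>c\<close> is included because it later becomes the
  noiseless signal.\<close>

lemma nn_integral_cgauss_density:
  assumes "0 < s"
  shows "(\<integral>\<^sup>+z. ennreal (cgauss_density s (z - c)) \<partial>lborel) = 1"
proof -
  have eq: "ennreal (cgauss_density s z) =
      (\<Prod>b\<in>Basis. ennreal (exp (- (z \<bullet> b)\<^sup>2 / s) / sqrt (pi * s)))" for z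
  proof -
    have "cgauss_density s z = (exp (- (Re z)\<^sup>2 / s) / sqrt (pi * s)) * (exp (- (Im z)\<^sup>2 / s) / sqrt (pi * s))"
      using assms by (simp add: cgauss_density_def cmod_power2 mult_exp_exp add_divide_distrib diff_divide_distrib)
    then show ?thesis
      using assms by (simp add: Basis_complex_def inner_complex_def ennreal_mult[symmetric])
  qed
  have "(\<integral>\<^sup>+z. ennreal (cgauss_density s (z - c)) \<partial>lborel) = (\<integral>\<^sup>+z. ennreal (cgauss_density s z) \<partial>lborel)"
    by (rule nn_integral_lborel_shift) measurable
  also have "\<dots> = (\<Prod>b\<in>(Basis::complex set). \<integral>\<^sup>+x. ennreal (exp (- x\<^sup>2 / s) / sqrt (pi * s)) \<partial>lborel)"
    unfolding eq by (rule nn_integral_lborel_prod) auto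
  also have "\<dots> = 1"
    using nn_integral_gauss_real[OF assms] by simp
  finally show ?thesis .
qed

lemma prob_space_cgauss: "0 < s \<Longrightarrow> prob_space (cgauss s)"
  using nn_integral_cgauss_density[of s 0]
  by (intro prob_spaceI) (simp add: cgauss_def emeasure_density)

text \<open>Completing the square.\<close>

lemma nn_integral_cgauss_convolution:
  assumes a: "0 < a" and b: "0 < b"
  shows "(\<integral>\<^sup>+x. ennreal (cgauss_density a (y - g * x)) \<partial>cgauss b) =
    ennreal (cgauss_density (a + (cmod g)\<^sup>2 * b) y)"
proof -
  \<comment> \<open>\<open>s\<close> is the variance of \<open>y\<close> when
    \<open>y - g * x\<close> is noise of variance \<open>a\<close>; \<open>t\<close> and
    \<open>x0\<close> are the conditional variance and mean of \<open>x\<close> given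
    \<open>y\<close>.\<close>
  define s where "s = a + (cmod g)\<^sup>2 * b"
  define t where "t = a * b / s"
  define x0 where "x0 = of_real (b / s) * cnj g * y"
  have s: "0 < s"
    using a b by (simp add: s_def add_pos_nonneg)
  have t: "0 < t"
    using a b s by (simp add: t_def)
  have sq: "(cmod (y - g * x))\<^sup>2 / a + (cmod x)\<^sup>2 / b = (cmod (x - x0))\<^sup>2 / t + (cmod y)\<^sup>2 / s" for x
  proof -
    define P where "P = Re (cnj (g * x) * y)"
    have 1: "(cmod (y - g * x))\<^sup>2 = (cmod y)\<^sup>2 - 2 * P + (cmod g)\<^sup>2 * (cmod x)\<^sup>2"
      unfolding P_def cmod_power2 by (simp add: power2_eq_square algebra_simps)
    have 2: "(cmod (x - x0))\<^sup>2 = (cmod x)\<^sup>2 - 2 * (b / s) * P + (b / s)\<^sup>2 * (cmod g)\<^sup>2 * (cmod y)\<^sup>2"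
    proof -
      have "(cmod (x - of_real \<beta> * cnj g * y))\<^sup>2 =
          (cmod x)\<^sup>2 - 2 * \<beta> * P + \<beta>\<^sup>2 * (cmod g)\<^sup>2 * (cmod y)\<^sup>2" for \<beta>
        unfolding P_def cmod_power2 by simp algebra
      from this[of "b / s"] show ?thesis
        unfolding x0_def .
    qed
    \<comment> \<open>The squared moduli are replaced by free reals \<open>X\<close>,
      \<open>Y\<close>, \<open>G\<close>, so that only field arithmetic remains.\<close>
    have 3: "(Y - 2 * P + G * X) / a + X / b = (X - 2 * (b / s) * P + (b / s)\<^sup>2 * G * Y) / t + Y / s"
      if sG: "s = a + G * b" for X Y G
    proof -
      have "(X - 2 * (b / s) * P + (b / s)\<^sup>2 * G * Y) / t = X * (s / b) / a - 2 * P / a + (b * G) * Y / s / a"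
        using a b s by (simp add: t_def field_simps power2_eq_square)
      also have "s / b = a / b + G"
        using b sG by (simp add: field_simps)
      also have "b * G = s - a"
        using sG by simp
      finally show ?thesis
        using a b s by (simp add: diff_divide_distrib add_divide_distrib ring_distribs)
    qed
    show ?thesis
      unfolding 1 2 by (rule 3) (simp add: s_def)
  qed
  have dens: "cgauss_density b x * cgauss_density a (y - g * x) =
      cgauss_density s y * cgauss_density t (x - x0)" for x
  proof -
    have "pi * a * (pi * b) = pi * t * (pi * s)"
      using s by (simp add: t_def)
    then show ?thesis
      using sq[of x] a b s t
      by (simp add: cgauss_density_def mult_exp_exp field_simps)
  qed
  have "(\<integral>\<^sup>+x. ennreal (cgauss_density a (y - g * x)) \<partial>cgauss b) =
      (\<integral>\<^sup>+x. ennreal (cgauss_density s y) * ennreal (cgauss_density t (x - x0)) \<partial>lborel)"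
    using a b s t by (subst nn_integral_cgauss) (auto simp: dens ennreal_mult[symmetric])
  also have "\<dots> = ennreal (cgauss_density s y)"
    using t by (subst nn_integral_cmult) (auto simp: nn_integral_cgauss_density)
  finally show ?thesis
    by (simp add: s_def)
qed

text \<open>Tilting by the exponential turns the Gaussian of variance \<open>s\<close> into a
  multiple of that of variance \<open>s / (1 - \<kappa>)\<close>. This is the moment generating
  function of \<open>|Z|^2 / s\<close>, an exponential variable of mean 1.\<close>

lemma nn_integral_exp_cgauss_density:
  assumes s: "0 < s" and \<kappa>: "\<kappa> < 1"
  shows "(\<integral>\<^sup>+z. ennreal (exp (\<kappa> * (cmod (z - c))\<^sup>2 / s) * cgauss_density s (z - c)) \<partial>lborel) =
    ennreal (1 / (1 - \<kappa>))"
proof -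
  define t where "t = s / (1 - \<kappa>)"
  have t: "0 < t"
    using assms by (simp add: t_def)
  have "exp (\<kappa> * (cmod z)\<^sup>2 / s) * cgauss_density s z = 1 / (1 - \<kappa>) * cgauss_density t z" for z
  proof -
    have "\<kappa> * (cmod z)\<^sup>2 / s - (cmod z)\<^sup>2 / s = - (cmod z)\<^sup>2 / t"
      using s \<kappa> by (simp add: t_def field_simps)
    then have "exp (\<kappa> * (cmod z)\<^sup>2 / s) * exp (- (cmod z)\<^sup>2 / s) = exp (- (cmod z)\<^sup>2 / t)"
      by (simp add: mult_exp_exp)
    then show ?thesis
      using s \<kappa> by (simp add: cgauss_density_def t_def)
  qed
  then have "(\<integral>\<^sup>+z. ennreal (exp (\<kappa> * (cmod (z - c))\<^sup>2 / s) * cgauss_density s (z - c)) \<partial>lborel) =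
      (\<integral>\<^sup>+z. ennreal (1 / (1 - \<kappa>)) * ennreal (cgauss_density t (z - c)) \<partial>lborel)"
    using \<kappa> t by (intro nn_integral_cong) (simp add: ennreal_mult[symmetric])
  also have "\<dots> = ennreal (1 / (1 - \<kappa>))"
    using t by (subst nn_integral_cmult) (auto simp: nn_integral_cgauss_density)
  finally show ?thesis .
qed

lemma emeasure_lborel_complex_ball:
  assumes "0 \<le> t"
  shows "emeasure lborel (ball (0::complex) t) = ennreal (pi * t\<^sup>2)"
  using assms by (simp add: emeasure_ball unit_ball_vol_2)

text \<open>The density is at most \<open>1 / pi\<close> everywhere and at least
  \<open>exp (- 1) / pi\<close> on the unit disc, and a disc of squared radius \<open>u\<close> has
  area \<open>pi * u\<close>. The truncation \<open>min u 1\<close> keeps the disc of the lower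
  bound inside the unit disc.\<close>

lemma emeasure_cgauss_less:
  assumes "0 < u"
  shows "emeasure (cgauss 1) {z. (cmod z)\<^sup>2 < u} \<le> ennreal u"
    and "ennreal (min u 1 / exp 1) \<le> emeasure (cgauss 1) {z. (cmod z)\<^sup>2 < u}"
proof -
  have ball: "{z. (cmod z)\<^sup>2 < t} = ball 0 (sqrt t)" for t
  proof -
    have "(cmod z)\<^sup>2 < t \<longleftrightarrow> cmod z < sqrt t" for z
      using real_sqrt_less_iff[of "(cmod z)\<^sup>2" t] by (simp del: real_sqrt_less_iff)
    then show ?thesis
      unfolding ball_def dist_0_norm by (rule Collect_cong)
  qed
  have e: "emeasure (cgauss 1) {z. (cmod z)\<^sup>2 < t} =
      (\<integral>\<^sup>+z\<in>ball 0 (sqrt t). ennreal (cgauss_density 1 z) \<partial>lborel)" for t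
    unfolding ball cgauss_def by (rule emeasure_density) simp_all
  have c: "(\<integral>\<^sup>+z\<in>ball (0::complex) (sqrt t). ennreal (k / pi) \<partial>lborel) = ennreal (k * t)" if "0 \<le> t" "0 \<le> k" for t k
    using that by (simp add: nn_integral_cmult_indicator emeasure_lborel_complex_ball ennreal_mult[symmetric])
  have "emeasure (cgauss 1) {z. (cmod z)\<^sup>2 < u} \<le> (\<integral>\<^sup>+z\<in>ball (0::complex) (sqrt u). ennreal (1 / pi) \<partial>lborel)"
    unfolding e by (intro nn_integral_mono mult_right_mono ennreal_leI) (auto simp: cgauss_density_def divide_right_mono)
  then show "emeasure (cgauss 1) {z. (cmod z)\<^sup>2 < u} \<le> ennreal u"
    using c[of u 1] assms by simp
  have "ennreal (min u 1 / exp 1) = (\<integral>\<^sup>+z\<in>ball (0::complex) (sqrt (min u 1)). ennreal ((1 / exp 1) / pi) \<partial>lborel)"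
    using c[of "min u 1" "1 / exp 1"] assms by simp
  also have "\<dots> \<le> (\<integral>\<^sup>+z\<in>ball 0 (sqrt (min u 1)). ennreal (cgauss_density 1 z) \<partial>lborel)"
  proof (intro nn_integral_mono)
    fix z :: complex
    have "1 / exp 1 / pi \<le> cgauss_density 1 z" if "z \<in> ball 0 (sqrt (min u 1))"
    proof -
      from that have "(cmod z)\<^sup>2 < min u 1"
        using ball by blast
      then have "exp (- 1) \<le> exp (- (cmod z)\<^sup>2)"
        by simp
      then show ?thesis
        by (simp add: cgauss_density_def exp_minus divide_right_mono field_simps)
    qed
    then show "ennreal (1 / exp 1 / pi) * indicator (ball 0 (sqrt (min u 1))) z
        \<le> ennreal (cgauss_density 1 z) * indicator (ball 0 (sqrt (min u 1))) z"
      by (auto split: split_indicator intro: ennreal_leI)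
  qed
  also have "\<dots> = emeasure (cgauss 1) {z. (cmod z)\<^sup>2 < min u 1}"
    by (rule e[symmetric])
  also have "\<dots> \<le> emeasure (cgauss 1) {z. (cmod z)\<^sup>2 < u}"
    by (intro emeasure_mono) auto
  finally show "ennreal (min u 1 / exp 1) \<le> emeasure (cgauss 1) {z. (cmod z)\<^sup>2 < u}" .
qed

text \<open>Circles are Lebesgue null. With \<open>a = 0\<close> this discards a vanishing gain,
  with general \<open>a\<close> the boundary of the outage event.\<close>

lemma AE_cgauss_cmod_neq: "AE z in cgauss s. cmod z \<noteq> a"
proof -
  have "sphere (0::complex) a \<in> null_sets lborel"
    using negligible_sphere[of 0 a] by (simp add: negligible_iff_null_sets null_sets_completion_iff)
  then have "AE z in lborel. cmod z \<noteq> a"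
    using AE_not_in by fastforce
  then show ?thesis
    unfolding cgauss_def by (subst AE_density) auto
qed

section \<open>Random coding with maximum-likelihood decoding\<close>

text \<open>Finitely many values have a maximum, so the \<open>LEAST\<close> in the decoder picks a
  genuine maximiser.\<close>

lemma is_arg_max_ml_decode:
  assumes "0 < N"
  shows "is_arg_max L (\<lambda>m. m < N) (ml_decode L N)"
proof -
  have "Max (L ` {..<N}) \<in> L ` {..<N}"
    using assms by (intro Max_in) auto
  then obtain m where m: "m < N" "L m = Max (L ` {..<N})"
    by auto
  then have "is_arg_max L (\<lambda>m. m < N) m"
    by (auto simp: is_arg_max_def not_less intro!: Max_ge)
  then show ?thesis
    unfolding ml_decode_def by (rule LeastI)
qed

lemma ml_decode_less: "0 < N \<Longrightarrow> ml_decode L N < N"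
  using is_arg_max_ml_decode[of N L] by (simp add: is_arg_max_def)

lemma le_ml_decode: "w < N \<Longrightarrow> L w \<le> L (ml_decode L N)"
  using is_arg_max_ml_decode[of N L] unfolding is_arg_max_def by (metis gr_implies_not0 gr_zeroI not_less)

lemma measurable_ml_decode [measurable]:
  assumes [measurable]: "\<And>m. (\<lambda>x. L x m) \<in> borel_measurable M"
  shows "(\<lambda>x. ml_decode (L x) N) \<in> measurable M (count_space UNIV)"
  unfolding ml_decode_def is_arg_max_def by measurable

text \<open>
  In the next two lemmas, \<open>C\<close> is the law of the code-book, \<open>L (c, y) m\<close> the density of the output
  \<open>y\<close> given message \<open>m\<close>, and \<open>q\<close> the output density averaged over the code-book.
  If the transmitted \<open>w\<close> loses against \<open>m\<close> although its likelihood exceeds \<open>T q\<close>, then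
  \<open>1 \<le> L m / (T q)\<close>, and \<open>m\<close> is independent of the output, so the latter has mean \<open>1 / T\<close>.
\<close>

lemma random_coding_error_le:
  fixes L :: "'c \<times> 'y \<Rightarrow> nat \<Rightarrow> real"
  assumes C: "prob_space C" and \<nu>: "sigma_finite_measure \<nu>"
    and L[measurable]: "\<And>m. (\<lambda>p. L p m) \<in> borel_measurable (C \<Otimes>\<^sub>M \<nu>)"
    and q[measurable]: "q \<in> borel_measurable \<nu>"
    and L0: "\<And>p m. 0 \<le> L p m" and q0: "\<And>y. 0 < q y"
    and q1: "(\<integral>\<^sup>+y. ennreal (q y) \<partial>\<nu>) = 1"
    and pair: "\<And>m y. m < N \<Longrightarrow> m \<noteq> w \<Longrightarrow> y \<in> space \<nu> \<Longrightarrow>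
      (\<integral>\<^sup>+c. ennreal (L (c, y) w * L (c, y) m) \<partial>C) = ennreal ((q y)\<^sup>2)"
    and w: "w < N" and T: "0 < T"
  shows "(\<integral>\<^sup>+p. ennreal (L p w) * indicator {p. ml_decode (L p) N \<noteq> w} p \<partial>(C \<Otimes>\<^sub>M \<nu>)) \<le>
    (\<integral>\<^sup>+p. ennreal (L p w) * indicator {p. L p w \<le> T * q (snd p)} p \<partial>(C \<Otimes>\<^sub>M \<nu>)) + ennreal (real N / T)"
proof -
  interpret C: prob_space C by (rule C)
  interpret \<nu>: sigma_finite_measure \<nu> by (rule \<nu>)
  interpret pair_sigma_finite C \<nu> ..
  \<comment> \<open>\<open>F m\<close> is \<open>L w\<close> times the ratio
    \<open>L m / (T q)\<close>. Integrated over the code-book first, its numerator becomes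
    \<open>q^2\<close> by \<open>pair\<close>, which leaves \<open>q / T\<close>.\<close>
  define F where "F m p = ennreal (L p w * L p m / (T * q (snd p)))" for m p
  have F[measurable]: "F m \<in> borel_measurable (C \<Otimes>\<^sub>M \<nu>)" for m
    unfolding F_def by measurable
  have Fint: "(\<integral>\<^sup>+p. F m p \<partial>(C \<Otimes>\<^sub>M \<nu>)) = ennreal (1 / T)" if m: "m < N" "m \<noteq> w" for m
  proof -
    have "(\<integral>\<^sup>+p. F m p \<partial>(C \<Otimes>\<^sub>M \<nu>)) = (\<integral>\<^sup>+y. \<integral>\<^sup>+c. F m (c, y) \<partial>C \<partial>\<nu>)"
      by (rule nn_integral_snd[symmetric]) measurable
    also have "\<dots> = (\<integral>\<^sup>+y. ennreal (1 / T) * ennreal (q y) \<partial>\<nu>)"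
    proof (intro nn_integral_cong)
      fix y assume y[measurable]: "y \<in> space \<nu>"
      have "(\<integral>\<^sup>+c. F m (c, y) \<partial>C) = (\<integral>\<^sup>+c. ennreal (1 / (T * q y)) * ennreal (L (c, y) w * L (c, y) m) \<partial>C)"
        unfolding F_def using T q0[of y] L0 by (intro nn_integral_cong) (simp add: ennreal_mult[symmetric])
      also have "\<dots> = ennreal (1 / (T * q y)) * ennreal ((q y)\<^sup>2)"
        by (subst nn_integral_cmult) (use pair[OF m y] in auto)
      also have "\<dots> = ennreal (1 / T) * ennreal (q y)"
        using T q0[of y] by (simp add: ennreal_mult[symmetric] power2_eq_square)
      finally show "(\<integral>\<^sup>+c. F m (c, y) \<partial>C) = ennreal (1 / T) * ennreal (q y)" .
    qed
    also have "\<dots> = ennreal (1 / T)"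
      by (subst nn_integral_cmult) (simp_all add: q1)
    finally show ?thesis .
  qed
  have "(\<integral>\<^sup>+p. ennreal (L p w) * indicator {p. ml_decode (L p) N \<noteq> w} p \<partial>(C \<Otimes>\<^sub>M \<nu>)) \<le>
    (\<integral>\<^sup>+p. ennreal (L p w) * indicator {p. L p w \<le> T * q (snd p)} p + (\<Sum>m\<in>{..<N} - {w}. F m p) \<partial>(C \<Otimes>\<^sub>M \<nu>))"
  proof (intro nn_integral_mono)
    fix p
    show "ennreal (L p w) * indicator {p. ml_decode (L p) N \<noteq> w} p \<le>
        ennreal (L p w) * indicator {p. L p w \<le> T * q (snd p)} p + (\<Sum>m\<in>{..<N} - {w}. F m p)"
    \<comment> \<open>In the complementary case the decoder is right or the threshold is missed, and
      the first summand alone suffices.\<close>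
    proof (cases "ml_decode (L p) N \<noteq> w \<and> T * q (snd p) < L p w")
      case True
      let ?m = "ml_decode (L p) N"
      have m: "?m \<in> {..<N} - {w}"
        using True w ml_decode_less[of N "L p"] by auto
      have "T * q (snd p) \<le> L p ?m"
        using True le_ml_decode[OF w, of "L p"] by linarith
      then have "L p w * (T * q (snd p)) \<le> L p w * L p ?m"
        using L0 by (intro mult_left_mono) auto
      then have "L p w \<le> L p w * L p ?m / (T * q (snd p))"
        using T q0[of "snd p"] by (simp add: pos_le_divide_eq)
      then have "ennreal (L p w) \<le> F ?m p"
        unfolding F_def by (rule ennreal_leI)
      also have "\<dots> \<le> (\<Sum>m\<in>{..<N} - {w}. F m p)"
        using m by (intro member_le_sum) auto
      finally show ?thesis
        using True by simp
    qed (auto simp: not_less split: split_indicator)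
  qed
  also have "\<dots> = (\<integral>\<^sup>+p. ennreal (L p w) * indicator {p. L p w \<le> T * q (snd p)} p \<partial>(C \<Otimes>\<^sub>M \<nu>)) +
      (\<Sum>m\<in>{..<N} - {w}. \<integral>\<^sup>+p. F m p \<partial>(C \<Otimes>\<^sub>M \<nu>))"
    by (subst nn_integral_add) (measurable, simp add: nn_integral_sum)
  also have "(\<Sum>m\<in>{..<N} - {w}. \<integral>\<^sup>+p. F m p \<partial>(C \<Otimes>\<^sub>M \<nu>)) = (\<Sum>m\<in>{..<N} - {w}. ennreal (1 / T))"
    by (intro sum.cong refl Fint) auto
  also have "\<dots> \<le> (\<Sum>m\<in>{..<N}. ennreal (1 / T))"
    by (intro sum_mono2) auto
  also have "\<dots> = ennreal (real N / T)"
    using T by (simp add: ennreal_of_nat_eq_real_of_nat ennreal_mult[symmetric])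
  finally show ?thesis
    by simp
qed

text \<open>The converse does not depend on the decoder: the decision regions are disjoint.\<close>

lemma random_coding_correct_le:
  fixes L :: "'c \<times> 'y \<Rightarrow> nat \<Rightarrow> real"
  assumes C: "prob_space C" and \<nu>: "sigma_finite_measure \<nu>"
    and L[measurable]: "\<And>m. (\<lambda>p. L p m) \<in> borel_measurable (C \<Otimes>\<^sub>M \<nu>)"
    and q[measurable]: "q \<in> borel_measurable \<nu>"
    and q0: "\<And>y. 0 < q y"
    and q1: "(\<integral>\<^sup>+y. ennreal (q y) \<partial>\<nu>) = 1"
    and T: "0 < T"
  shows "(\<Sum>w<N. \<integral>\<^sup>+p. ennreal (L p w) * indicator {p. ml_decode (L p) N = w} p \<partial>(C \<Otimes>\<^sub>M \<nu>)) \<le>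
    (\<Sum>w<N. \<integral>\<^sup>+p. ennreal (L p w) * indicator {p. T * q (snd p) < L p w} p \<partial>(C \<Otimes>\<^sub>M \<nu>)) + ennreal T"
proof -
  interpret C: prob_space C by (rule C)
  interpret \<nu>: sigma_finite_measure \<nu> by (rule \<nu>)
  interpret pair_sigma_finite C \<nu> ..
  let ?d = "\<lambda>p. ml_decode (L p) N"
  \<comment> \<open>Where the likelihood does not pass the threshold it is replaced by
    \<open>T * q\<close>, whose sum over the disjoint decision regions has integral at most
    \<open>T\<close>.\<close>
  have "(\<Sum>w<N. \<integral>\<^sup>+p. ennreal (L p w) * indicator {p. ?d p = w} p \<partial>(C \<Otimes>\<^sub>M \<nu>)) \<le>
      (\<Sum>w<N. \<integral>\<^sup>+p. ennreal (L p w) * indicator {p. T * q (snd p) < L p w} p +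
        ennreal (T * q (snd p)) * indicator {p. ?d p = w} p \<partial>(C \<Otimes>\<^sub>M \<nu>))"
    by (intro sum_mono nn_integral_mono) (auto simp: not_less ennreal_leI split: split_indicator)
  also have "\<dots> = (\<Sum>w<N. \<integral>\<^sup>+p. ennreal (L p w) * indicator {p. T * q (snd p) < L p w} p \<partial>(C \<Otimes>\<^sub>M \<nu>)) +
      (\<integral>\<^sup>+p. (\<Sum>w<N. ennreal (T * q (snd p)) * indicator {p. ?d p = w} p) \<partial>(C \<Otimes>\<^sub>M \<nu>))"
    by (subst nn_integral_sum, measurable, subst sum.distrib[symmetric], intro sum.cong refl nn_integral_add) measurable
  also have "(\<integral>\<^sup>+p. (\<Sum>w<N. ennreal (T * q (snd p)) * indicator {p. ?d p = w} p) \<partial>(C \<Otimes>\<^sub>M \<nu>)) \<le>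
      (\<integral>\<^sup>+p. ennreal (T * q (snd p)) \<partial>(C \<Otimes>\<^sub>M \<nu>))"
  proof (intro nn_integral_mono)
    fix p
    have "(\<Sum>w<N. ennreal (T * q (snd p)) * indicator {p. ?d p = w} p) =
        (\<Sum>w<N. if w = ?d p then ennreal (T * q (snd p)) else 0)"
      by (intro sum.cong) auto
    then show "(\<Sum>w<N. ennreal (T * q (snd p)) * indicator {p. ?d p = w} p) \<le> ennreal (T * q (snd p))"
      by (simp add: sum.delta)
  qed
  also have "(\<integral>\<^sup>+p. ennreal (T * q (snd p)) \<partial>(C \<Otimes>\<^sub>M \<nu>)) = (\<integral>\<^sup>+c. \<integral>\<^sup>+y. ennreal T * ennreal (q y) \<partial>\<nu> \<partial>C)"
    using T q0 by (subst \<nu>.nn_integral_fst[symmetric]) (simp_all add: ennreal_mult[symmetric] less_imp_le)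
  also have "\<dots> = ennreal T"
    by (simp add: nn_integral_cmult q1 C.emeasure_space_1)
  finally show ?thesis
    by simp
qed

section \<open>One block over fixed channel gains\<close>

text \<open>Off the index set every point of the product space takes the constant value
  \<open>undefined\<close>, so measurability holds for all \<open>i\<close>, and symbols
  \<open>(m, k)\<close> need no range check.\<close>

lemma measurable_PiM_component_borel:
  fixes f :: "'b \<Rightarrow> 'i \<Rightarrow> 'a::topological_space"
  assumes f: "f \<in> measurable M (PiM I N)" and N: "\<And>i. sets (N i) = sets borel"
  shows "(\<lambda>x. f x i) \<in> borel_measurable M"
proof (cases "i \<in> I")
  case True
  then have "(\<lambda>x. f x i) \<in> measurable M (N i)"
    using measurable_compose[OF f measurable_component_singleton] by simp
  then show ?thesis
    using measurable_cong_sets[OF refl N] by blast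
next
  case False
  then have "f x i = undefined" if "x \<in> space M" for x
    using measurable_space[OF f that] by (auto simp: space_PiM PiE_def extensional_def)
  then show ?thesis
    by (simp cong: measurable_cong)
qed

text \<open>\<open>t / (1 + t)\<close> is the optimal Chernoff parameter for a mean-one exponential
  variable to reach the level \<open>1 + t\<close>; the value is the resulting factor per
  symbol.\<close>

lemma nn_integral_chernoff_cgauss:
  assumes "0 < s" and "-1 < t"
  shows "(\<integral>\<^sup>+z. ennreal (exp (t / (1 + t) * (cmod (z - c))\<^sup>2 / s - t) * cgauss_density s (z - c)) \<partial>lborel) =
    ennreal ((1 + t) * exp (- t))"
proof -
  have "1 - t / (1 + t) = 1 / (1 + t)" "t / (1 + t) < 1"
    using assms by (simp_all add: field_simps)
  note int = nn_integral_exp_cgauss_density[OF assms(1) this(2), of c, unfolded this(1)]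
  have "(\<integral>\<^sup>+z. ennreal (exp (t / (1 + t) * (cmod (z - c))\<^sup>2 / s - t) * cgauss_density s (z - c)) \<partial>lborel) =
      (\<integral>\<^sup>+z. ennreal (exp (- t)) * ennreal (exp (t / (1 + t) * (cmod (z - c))\<^sup>2 / s) * cgauss_density s (z - c)) \<partial>lborel)"
    using assms by (intro nn_integral_cong) (simp add: ennreal_mult[symmetric] exp_diff exp_minus field_simps)
  also have "\<dots> = ennreal (exp (- t)) *
      (\<integral>\<^sup>+z. ennreal (exp (t / (1 + t) * (cmod (z - c))\<^sup>2 / s) * cgauss_density s (z - c)) \<partial>lborel)"
    by (rule nn_integral_cmult) measurable
  also note int
  also have "ennreal (exp (- t)) * ennreal (1 / (1 / (1 + t))) = ennreal ((1 + t) * exp (- t))"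
    using assms by (simp add: ennreal_mult[symmetric] mult.commute)
  finally show ?thesis .
qed

text \<open>Keeping the factor \<open>t\<close> on both sides treats both tails at once: for
  \<open>t > 0\<close> the event says that the sum is at least \<open>(1 + t) * card K\<close>, for
  \<open>t < 0\<close> that it is at most that.\<close>

lemma chernoff_indicator_le:
  fixes S :: "'k \<Rightarrow> real" and t :: real
  assumes "-1 < t" "finite K" and A: "x \<in> A \<Longrightarrow> t * (1 + t) * card K \<le> t * (\<Sum>k\<in>K. S k)"
  shows "indicator A x \<le> (\<Prod>k\<in>K. ennreal (exp (t / (1 + t) * S k - t)))"
proof -
  have "1 \<le> exp (\<Sum>k\<in>K. t / (1 + t) * S k - t)" if "x \<in> A"
  proof -
    have "t * card K \<le> t * (\<Sum>k\<in>K. S k) / (1 + t)"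
      using A[OF that] assms(1,2) by (simp add: pos_le_divide_eq mult_ac)
    also have "\<dots> = (\<Sum>k\<in>K. t / (1 + t) * S k)"
      by (simp add: sum_distrib_left sum_divide_distrib)
    finally show ?thesis
      by (simp add: sum_subtractf mult.commute)
  qed
  then show ?thesis
    using assms(2) by (auto simp: prod_ennreal exp_sum[symmetric] split: split_indicator)
qed

text \<open>For fixed gains the listening time and the number of messages are mere numbers, so
  \<open>l'\<close> and \<open>N\<close> stay arbitrary here.\<close>

locale ddf_block =
  fixes sv E :: real and g1 g2 :: complex and l' N l :: nat
  assumes sv: "0 < sv" and E: "0 < E"
begin

definition codebooks :: "((nat \<times> nat \<Rightarrow> complex) \<times> (nat \<times> nat \<Rightarrow> complex)) measure" where
  "codebooks = PiM ({..<N} \<times> {1..l}) (\<lambda>_. cgauss E) \<Otimes>\<^sub>M PiM ({..<N} \<times> {1..l}) (\<lambda>_. cgauss E)"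

text \<open>Lebesgue rather than Gaussian: the reference measure against which \<open>lik\<close> is
  the density of the received block.\<close>

definition outputs :: "(nat \<Rightarrow> complex) measure" where
  "outputs = PiM {1..l} (\<lambda>_. lborel)"

definition lik where
  "lik p m = ddf_likelihood sv l g1 g2 l' (fst (fst p)) (snd (fst p)) (snd p) m"

definition out_var :: "nat \<Rightarrow> real" where
  "out_var k = sv + (cmod g1)\<^sup>2 * E + (if l' < k then (cmod g2)\<^sup>2 * E else 0)"

text \<open>This is the \<open>q\<close> of the random-coding lemmas. It is a product over time
  because different symbols use independent code-book entries.\<close>

definition out_dens :: "(nat \<Rightarrow> complex) \<Rightarrow> real" where
  "out_dens y = (\<Prod>k\<in>{1..l}. cgauss_density (out_var k) (y k))"

definition sig where
  "sig c m k = ddf_signal g1 g2 l' (fst c) (snd c) m k"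

lemma lik_eq: "lik (c, y) m = (\<Prod>k\<in>{1..l}. cgauss_density sv (y k - sig c m k))"
  by (simp add: lik_def ddf_likelihood_def sig_def)

lemma out_var_pos: "0 < out_var k"
  using sv E by (auto simp: out_var_def intro!: add_pos_nonneg)

lemma out_dens_pos: "0 < out_dens y"
  unfolding out_dens_def by (intro prod_pos ballI cgauss_density_pos out_var_pos)

lemma lik_pos: "0 < lik p m"
  unfolding lik_def ddf_likelihood_def by (intro prod_pos ballI cgauss_density_pos sv)

lemma measurable_sig [measurable]:
  "(\<lambda>c. sig c m k) \<in> borel_measurable codebooks"
proof -
  note component = measurable_PiM_component_borel[where I = "{..<N} \<times> {1..l}" and N = "\<lambda>_. cgauss E"]
  have [measurable]: "(\<lambda>c. fst c (m, k)) \<in> borel_measurable codebooks"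
    "(\<lambda>c. snd c (m, k)) \<in> borel_measurable codebooks"
    unfolding codebooks_def by (auto intro!: component)
  show ?thesis
    unfolding sig_def ddf_signal_def by measurable
qed

lemma measurable_outputs [measurable (raw)]:
  "f \<in> measurable M outputs \<Longrightarrow> (\<lambda>x. f x k) \<in> borel_measurable M"
  unfolding outputs_def by (rule measurable_PiM_component_borel[where N = "\<lambda>_. lborel"]) simp_all

lemma measurable_snd_outputs [measurable]:
  "(\<lambda>p. snd p k) \<in> borel_measurable (M \<Otimes>\<^sub>M outputs)"
  by (rule measurable_outputs) simp

lemma measurable_lik [measurable]: "(\<lambda>p. lik p m) \<in> borel_measurable (codebooks \<Otimes>\<^sub>M outputs)"
proof -
  have "(\<lambda>p. lik (fst p, snd p) m) \<in> borel_measurable (codebooks \<Otimes>\<^sub>M outputs)"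
    unfolding lik_eq by measurable
  then show ?thesis
    by simp
qed

lemma measurable_out_dens [measurable]: "out_dens \<in> borel_measurable outputs"
  unfolding out_dens_def by measurable

lemma prob_space_codebooks: "prob_space codebooks"
  unfolding codebooks_def by (intro prob_space_pair prob_space_PiM prob_space_cgauss E)

lemma product_sigma_finite_lborel: "product_sigma_finite (\<lambda>_. lborel :: complex measure)"
  by standard

lemma sigma_finite_outputs: "sigma_finite_measure outputs"
  unfolding outputs_def
  by (rule product_sigma_finite.sigma_finite[OF product_sigma_finite_lborel]) simp

lemma nn_integral_outputs_prod:
  assumes "\<And>k. k \<in> {1..l} \<Longrightarrow> f k \<in> borel_measurable borel"
  shows "(\<integral>\<^sup>+y. (\<Prod>k\<in>{1..l}. f k (y k)) \<partial>outputs) = (\<Prod>k\<in>{1..l}. \<integral>\<^sup>+z. f k z \<partial>lborel)"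
  unfolding outputs_def using assms
  by (intro product_sigma_finite.product_nn_integral_prod[OF product_sigma_finite_lborel]) auto

lemma nn_integral_out_dens: "(\<integral>\<^sup>+y. ennreal (out_dens y) \<partial>outputs) = 1"
proof -
  have "(\<integral>\<^sup>+y. ennreal (out_dens y) \<partial>outputs) =
      (\<integral>\<^sup>+y. (\<Prod>k\<in>{1..l}. ennreal (cgauss_density (out_var k) (y k - 0))) \<partial>outputs)"
    by (simp add: out_dens_def prod_ennreal out_var_pos)
  also have "\<dots> = 1"
    by (subst nn_integral_outputs_prod) (simp_all only: nn_integral_cgauss_density[OF out_var_pos] prod.neutral_const, measurable)
  finally show ?thesis .
qed

text \<open>One Gaussian convolution for the relay symbol, then one for the source symbol. A silent
  relay is treated as one with gain \<open>0\<close>.\<close>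

lemma nn_integral_codeword_symbols:
  "(\<integral>\<^sup>+u. \<integral>\<^sup>+v. ennreal (cgauss_density sv (y - (g1 * u + (if l' < k then g2 * v else 0)))) \<partial>cgauss E \<partial>cgauss E) =
    ennreal (cgauss_density (out_var k) y)"
proof -
  define g2' where "g2' = (if l' < k then g2 else 0)"
  have eq: "y - (g1 * u + (if l' < k then g2 * v else 0)) = (y - g1 * u) - g2' * v" for u v
    by (simp add: g2'_def)
  have pos: "0 < sv + (cmod g2')\<^sup>2 * E"
    using sv E by (auto intro!: add_pos_nonneg)
  have "sv + (cmod g2')\<^sup>2 * E + (cmod g1)\<^sup>2 * E = out_var k"
    by (simp add: g2'_def out_var_def)
  then show ?thesis
    unfolding eq nn_integral_cgauss_convolution[OF sv E] nn_integral_cgauss_convolution[OF pos E] by simp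
qed

text \<open>The symbols of different codewords are independent, so the integral factors over messages.\<close>

lemma nn_integral_codebooks_lik:
  assumes M: "M \<subseteq> {..<N}"
  shows "(\<integral>\<^sup>+c. (\<Prod>m\<in>M. ennreal (lik (c, y) m)) \<partial>codebooks) = ennreal (out_dens y) ^ card M"
proof -
  let ?I = "{..<N} \<times> {1..l}"
  have fin: "finite M"
    using M finite_subset by blast
  interpret product_sigma_finite "\<lambda>_::nat \<times> nat. cgauss E"
    using prob_space_cgauss[OF E] by (auto simp: product_sigma_finite_def intro: prob_space_imp_sigma_finite)
  interpret X: sigma_finite_measure "PiM ?I (\<lambda>_. cgauss E)"
    by (rule sigma_finite) simp
  \<comment> \<open>Messages outside \<open>M\<close> get the factor \<open>1\<close>, so that the
    integrand is a product over all code-book entries and the integral splits over the product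
    measure.\<close>
  define f where "f i u v = (if fst i \<in> M then ennreal (cgauss_density sv
    (y (snd i) - (g1 * u + (if l' < snd i then g2 * v else 0)))) else 1)" for i :: "nat \<times> nat" and u v
  have f1[measurable]: "(\<lambda>(u, v). f i u v) \<in> borel_measurable (borel \<Otimes>\<^sub>M borel)" for i
    unfolding f_def by measurable
  have f2[measurable]: "(\<lambda>v. f i u v) \<in> borel_measurable borel" for i u
    unfolding f_def by measurable
  have f2': "f i u \<in> borel_measurable (cgauss E)" for i u
    using f2 by (simp add: measurable_cong_sets[OF sets_cgauss refl])
  have f3: "(\<lambda>c. \<Prod>i\<in>?I. f i (fst c i) (snd c i)) \<in>
      borel_measurable (PiM ?I (\<lambda>_. cgauss E) \<Otimes>\<^sub>M PiM ?I (\<lambda>_. cgauss E))"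
    unfolding f_def by measurable
  have prodM: "(\<Prod>m\<in>M. \<Prod>k\<in>{1..l}. h (m, k)) = (\<Prod>i\<in>?I. if fst i \<in> M then h i else 1)" for h :: "nat \<times> nat \<Rightarrow> ennreal"
  proof -
    have "(\<Prod>m\<in>M. \<Prod>k\<in>{1..l}. h (m, k)) = (\<Prod>i\<in>M \<times> {1..l}. h i)"
      by (simp add: prod.cartesian_product)
    also have "\<dots> = (\<Prod>i\<in>M \<times> {1..l}. if fst i \<in> M then h i else 1)"
      by (intro prod.cong) auto
    also have "\<dots> = (\<Prod>i\<in>?I. if fst i \<in> M then h i else 1)"
      using M by (intro prod.mono_neutral_left) auto
    finally show ?thesis .
  qed
  have lik: "(\<Prod>m\<in>M. ennreal (lik (c, y) m)) = (\<Prod>i\<in>?I. f i (fst c i) (snd c i))" for c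
    unfolding f_def prodM[symmetric, where h = "\<lambda>i. ennreal (cgauss_density sv
      (y (snd i) - (g1 * fst c i + (if l' < snd i then g2 * snd c i else 0))))"]
    by (simp add: lik_eq sig_def ddf_signal_def prod_ennreal sv)
  have "(\<integral>\<^sup>+c. (\<Prod>m\<in>M. ennreal (lik (c, y) m)) \<partial>codebooks) =
      (\<integral>\<^sup>+x. \<integral>\<^sup>+xr. (\<Prod>i\<in>?I. f i (x i) (xr i)) \<partial>PiM ?I (\<lambda>_. cgauss E) \<partial>PiM ?I (\<lambda>_. cgauss E))"
    unfolding lik codebooks_def
    by (subst X.nn_integral_fst[symmetric]) (use f3 in simp_all)
  also have "\<dots> = (\<integral>\<^sup>+x. (\<Prod>i\<in>?I. \<integral>\<^sup>+v. f i (x i) v \<partial>cgauss E) \<partial>PiM ?I (\<lambda>_. cgauss E))"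
    by (intro nn_integral_cong product_nn_integral_prod) (simp_all add: f2')
  also have "\<dots> = (\<Prod>i\<in>?I. \<integral>\<^sup>+u. \<integral>\<^sup>+v. f i u v \<partial>cgauss E \<partial>cgauss E)"
    by (intro product_nn_integral_prod) auto
  also have "\<dots> = (\<Prod>i\<in>?I. if fst i \<in> M then ennreal (cgauss_density (out_var (snd i)) (y (snd i))) else 1)"
    using prob_space.emeasure_space_1[OF prob_space_cgauss[OF E]]
    by (intro prod.cong refl) (simp add: f_def nn_integral_codeword_symbols)
  also have "\<dots> = ennreal (out_dens y) ^ card M"
    unfolding prodM[symmetric, where h = "\<lambda>i. ennreal (cgauss_density (out_var (snd i)) (y (snd i)))"]
    by (simp add: out_dens_def prod_ennreal out_var_pos)
  finally show ?thesis .
qed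

lemma nn_integral_lik:
  assumes "m < N"
  shows "(\<integral>\<^sup>+c. ennreal (lik (c, y) m) \<partial>codebooks) = ennreal (out_dens y)"
  using nn_integral_codebooks_lik[of "{m}" y] assms by simp

text \<open>Independence of two distinct codewords, in the form of the premise \<open>pair\<close>
  of the union bound.\<close>

lemma nn_integral_lik_lik:
  assumes "m < N" "w < N" "m \<noteq> w"
  shows "(\<integral>\<^sup>+c. ennreal (lik (c, y) w * lik (c, y) m) \<partial>codebooks) = ennreal ((out_dens y)\<^sup>2)"
  using nn_integral_codebooks_lik[of "{w, m}" y] assms
  by (simp add: ennreal_mult less_imp_le[OF lik_pos] less_imp_le[OF out_dens_pos] ennreal_power power2_eq_square)

section \<open>Concentration of the energies and error bounds for one block\<close>

definition out_energy where
  "out_energy p = (\<Sum>k\<in>{1..l}. (cmod (snd p k))\<^sup>2 / out_var k)"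

definition noise_energy where
  "noise_energy w p = (\<Sum>k\<in>{1..l}. (cmod (snd p k - sig (fst p) w k))\<^sup>2 / sv)"

lemma measurable_out_energy [measurable]:
  "out_energy \<in> borel_measurable (codebooks \<Otimes>\<^sub>M outputs)"
  unfolding out_energy_def by measurable

lemma measurable_noise_energy [measurable]:
  "noise_energy w \<in> borel_measurable (codebooks \<Otimes>\<^sub>M outputs)"
  unfolding noise_energy_def by measurable

text \<open>Once the code-book is averaged, the output is Gaussian with variances
  \<open>out_var\<close>. Hence the code-book is integrated first, which turns \<open>lik\<close>
  into \<open>out_dens\<close>, and the exponential moment factors over time.\<close>

lemma out_energy_tail:
  fixes t :: real
  assumes w: "w < N" and t: "-1 < t"
  shows "(\<integral>\<^sup>+p. ennreal (lik p w) * indicator {p. t * (1 + t) * l \<le> t * out_energy p} p \<partial>(codebooks \<Otimes>\<^sub>M outputs))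
    \<le> ennreal (((1 + t) * exp (- t)) ^ l)"
proof -
  interpret C: prob_space codebooks by (rule prob_space_codebooks)
  interpret O: sigma_finite_measure outputs by (rule sigma_finite_outputs)
  interpret pair_sigma_finite codebooks outputs ..
  define h where "h k z = ennreal (exp (t / (1 + t) * ((cmod z)\<^sup>2 / out_var k) - t))" for k z
  have h[measurable]: "h k \<in> borel_measurable borel" for k
    unfolding h_def by measurable
  have [measurable]: "(\<lambda>p. h k (snd p k)) \<in> borel_measurable (codebooks \<Otimes>\<^sub>M outputs)" for k
    by (rule measurable_compose[OF measurable_snd_outputs h])
  have "(\<integral>\<^sup>+p. ennreal (lik p w) * indicator {p. t * (1 + t) * l \<le> t * out_energy p} p \<partial>(codebooks \<Otimes>\<^sub>M outputs))
      \<le> (\<integral>\<^sup>+p. ennreal (lik p w) * (\<Prod>k\<in>{1..l}. h k (snd p k)) \<partial>(codebooks \<Otimes>\<^sub>M outputs))"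
  proof (intro nn_integral_mono mult_left_mono)
    fix p
    show "indicator {p. t * (1 + t) * l \<le> t * out_energy p} p \<le> (\<Prod>k\<in>{1..l}. h k (snd p k))"
      unfolding h_def by (rule chernoff_indicator_le) (use t in \<open>simp_all add: out_energy_def\<close>)
  qed simp
  also have "\<dots> = (\<integral>\<^sup>+y. \<integral>\<^sup>+c. ennreal (lik (c, y) w) * (\<Prod>k\<in>{1..l}. h k (y k)) \<partial>codebooks \<partial>outputs)"
    by (subst nn_integral_snd[symmetric])
      (auto intro!: borel_measurable_times_ennreal borel_measurable_prod_ennreal)
  also have "\<dots> = (\<integral>\<^sup>+y. (\<Prod>k\<in>{1..l}. h k (y k) * ennreal (cgauss_density (out_var k) (y k))) \<partial>outputs)"
  proof (intro nn_integral_cong)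
    fix y assume [measurable]: "y \<in> space outputs"
    show "(\<integral>\<^sup>+c. ennreal (lik (c, y) w) * (\<Prod>k\<in>{1..l}. h k (y k)) \<partial>codebooks) =
        (\<Prod>k\<in>{1..l}. h k (y k) * ennreal (cgauss_density (out_var k) (y k)))"
      by (subst nn_integral_multc)
        (measurable, simp add: nn_integral_lik[OF w] prod.distrib out_dens_def prod_ennreal out_var_pos mult.commute)
  qed
  also have "\<dots> = (\<Prod>k\<in>{1..l}. \<integral>\<^sup>+z. h k z * ennreal (cgauss_density (out_var k) z) \<partial>lborel)"
    by (rule nn_integral_outputs_prod) measurable
  also have "\<dots> = (\<Prod>k\<in>{1..l}. ennreal ((1 + t) * exp (- t)))"
    using nn_integral_chernoff_cgauss[OF out_var_pos t, of 0]
    by (intro prod.cong refl) (simp add: h_def ennreal_mult[symmetric] out_var_pos)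
  also have "\<dots> = ennreal (((1 + t) * exp (- t)) ^ l)"
    using t by (simp add: ennreal_power)
  finally show ?thesis .
qed

text \<open>Here the order of integration is opposite: for a fixed code-book, output minus signal is
  the noise, so the inner integral over the output does not depend on the code-book.\<close>

lemma noise_energy_tail:
  fixes t :: real
  assumes t: "-1 < t"
  shows "(\<integral>\<^sup>+p. ennreal (lik p w) * indicator {p. t * (1 + t) * l \<le> t * noise_energy w p} p \<partial>(codebooks \<Otimes>\<^sub>M outputs))
    \<le> ennreal (((1 + t) * exp (- t)) ^ l)"
proof -
  interpret C: prob_space codebooks by (rule prob_space_codebooks)
  interpret O: sigma_finite_measure outputs by (rule sigma_finite_outputs)
  define h where "h z = ennreal (exp (t / (1 + t) * ((cmod z)\<^sup>2 / sv) - t))" for z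
  have h[measurable]: "h \<in> borel_measurable borel"
    unfolding h_def by measurable
  have [measurable]: "(\<lambda>p. h (snd p k - sig (fst p) w k)) \<in> borel_measurable (codebooks \<Otimes>\<^sub>M outputs)" for k
    by (rule measurable_compose[OF _ h]) measurable
  have "(\<integral>\<^sup>+p. ennreal (lik p w) * indicator {p. t * (1 + t) * l \<le> t * noise_energy w p} p \<partial>(codebooks \<Otimes>\<^sub>M outputs))
      \<le> (\<integral>\<^sup>+p. ennreal (lik p w) * (\<Prod>k\<in>{1..l}. h (snd p k - sig (fst p) w k)) \<partial>(codebooks \<Otimes>\<^sub>M outputs))"
  proof (intro nn_integral_mono mult_left_mono)
    fix p
    show "indicator {p. t * (1 + t) * l \<le> t * noise_energy w p} p \<le> (\<Prod>k\<in>{1..l}. h (snd p k - sig (fst p) w k))"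
      unfolding h_def by (rule chernoff_indicator_le) (use t in \<open>simp_all add: noise_energy_def\<close>)
  qed simp
  also have "\<dots> = (\<integral>\<^sup>+c. \<integral>\<^sup>+y. ennreal (lik (c, y) w) * (\<Prod>k\<in>{1..l}. h (y k - sig c w k)) \<partial>outputs \<partial>codebooks)"
    by (subst O.nn_integral_fst[symmetric])
      (auto intro!: borel_measurable_times_ennreal borel_measurable_prod_ennreal)
  also have "\<dots> = (\<integral>\<^sup>+c. ennreal (((1 + t) * exp (- t)) ^ l) \<partial>codebooks)"
  proof (intro nn_integral_cong)
    fix c
    have "(\<integral>\<^sup>+y. ennreal (lik (c, y) w) * (\<Prod>k\<in>{1..l}. h (y k - sig c w k)) \<partial>outputs) =
        (\<integral>\<^sup>+y. (\<Prod>k\<in>{1..l}. h (y k - sig c w k) * ennreal (cgauss_density sv (y k - sig c w k))) \<partial>outputs)"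
      by (simp add: lik_eq prod.distrib prod_ennreal sv mult.commute)
    also have "\<dots> = (\<Prod>k\<in>{1..l}. \<integral>\<^sup>+z. h (z - sig c w k) * ennreal (cgauss_density sv (z - sig c w k)) \<partial>lborel)"
      by (rule nn_integral_outputs_prod) measurable
    also have "\<dots> = (\<Prod>k\<in>{1..l}. ennreal ((1 + t) * exp (- t)))"
      using nn_integral_chernoff_cgauss[OF sv t]
      by (intro prod.cong refl) (simp add: h_def ennreal_mult[symmetric] sv)
    also have "\<dots> = ennreal (((1 + t) * exp (- t)) ^ l)"
      using t by (simp add: ennreal_power)
    finally show "(\<integral>\<^sup>+y. ennreal (lik (c, y) w) * (\<Prod>k\<in>{1..l}. h (y k - sig c w k)) \<partial>outputs) =
      ennreal (((1 + t) * exp (- t)) ^ l)" .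
  qed
  also have "\<dots> = ennreal (((1 + t) * exp (- t)) ^ l)"
    by (simp add: C.emeasure_space_1)
  finally show ?thesis .
qed

text \<open>The mutual information of the block in nats: \<open>out_var k / sv\<close> is one plus
  the signal-to-noise ratio at time \<open>k\<close>.\<close>

definition info :: real where
  "info = (\<Sum>k\<in>{1..l}. ln (out_var k / sv))"

text \<open>The normalising factors of the two Gaussian products yield \<open>info\<close>, their
  quadratic exponents the energies. Both energies concentrate around \<open>l\<close>, so the
  log-likelihood ratio stays close to \<open>info\<close>.\<close>

lemma ln_lik_out_dens:
  "ln (lik p w) = ln (out_dens (snd p)) + info + out_energy p - noise_energy w p"
proof -
  have ln: "ln (cgauss_density s z) = - ln (pi * s) - (cmod z)\<^sup>2 / s" if "0 < s" for s z
    using that by (simp add: cgauss_density_def ln_div)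
  have "ln (lik p w) = (\<Sum>k\<in>{1..l}. ln (cgauss_density sv (snd p k - sig (fst p) w k)))"
    unfolding lik_def ddf_likelihood_def sig_def by (rule ln_prod) (simp_all add: cgauss_density_pos[OF sv] less_imp_neq[symmetric])
  moreover have "ln (out_dens (snd p)) = (\<Sum>k\<in>{1..l}. ln (cgauss_density (out_var k) (snd p k)))"
    unfolding out_dens_def by (rule ln_prod) (simp_all add: cgauss_density_pos[OF out_var_pos] less_imp_neq[symmetric])
  ultimately show ?thesis
    using sv out_var_pos
    by (simp add: ln info_def out_energy_def noise_energy_def ln_mult ln_div less_imp_neq[symmetric]
        sum_subtractf sum.distrib sum_negf right_diff_distrib)
qed

definition chernoff_bound :: "real \<Rightarrow> real" where
  "chernoff_bound \<delta> = ((1 + \<delta>) * exp (- \<delta>)) ^ l + ((1 - \<delta>) * exp \<delta>) ^ l"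

lemma chernoff_bound_nonneg: "0 < \<delta> \<Longrightarrow> \<delta> < 1 \<Longrightarrow> 0 \<le> chernoff_bound \<delta>"
  by (simp add: chernoff_bound_def)

text \<open>The two signs \<open>t = \<delta>\<close> and \<open>t = - \<delta>\<close> of the tail bounds give the upper and the lower tail.\<close>

lemma error_le:
  fixes \<delta> :: real
  assumes w: "w < N" and \<delta>: "0 < \<delta>" "\<delta> < 1" and T: "0 < T" "ln T + 2 * \<delta> * l \<le> info"
  shows "(\<integral>\<^sup>+p. ennreal (lik p w) * indicator {p. ml_decode (lik p) N \<noteq> w} p \<partial>(codebooks \<Otimes>\<^sub>M outputs)) \<le>
    ennreal (chernoff_bound \<delta> + real N / T)"
proof -
  let ?P = "codebooks \<Otimes>\<^sub>M outputs"
  \<comment> \<open>Outside \<open>?A\<close> and \<open>?B\<close> the noise energy is below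
    \<open>(1 + \<delta>) * l\<close> and the output energy above \<open>(1 - \<delta>) * l\<close>,
    so the log-likelihood ratio exceeds \<open>info - 2 * \<delta> * l\<close>, hence
    \<open>ln T\<close>.\<close>
  let ?A = "{p. \<delta> * (1 + \<delta>) * l \<le> \<delta> * noise_energy w p}"
  let ?B = "{p. - \<delta> * (1 + - \<delta>) * l \<le> - \<delta> * out_energy p}"
  have "(\<integral>\<^sup>+p. ennreal (lik p w) * indicator {p. ml_decode (lik p) N \<noteq> w} p \<partial>?P) \<le>
      (\<integral>\<^sup>+p. ennreal (lik p w) * indicator {p. lik p w \<le> T * out_dens (snd p)} p \<partial>?P) + ennreal (real N / T)"
    using w T by (intro random_coding_error_le prob_space_codebooks sigma_finite_outputs nn_integral_lik_lik
        nn_integral_out_dens less_imp_le[OF lik_pos] out_dens_pos) measurable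
  also have "(\<integral>\<^sup>+p. ennreal (lik p w) * indicator {p. lik p w \<le> T * out_dens (snd p)} p \<partial>?P) \<le>
      (\<integral>\<^sup>+p. ennreal (lik p w) * indicator ?A p + ennreal (lik p w) * indicator ?B p \<partial>?P)"
  proof (intro nn_integral_mono)
    fix p
    have "p \<in> ?A \<or> p \<in> ?B" if "lik p w \<le> T * out_dens (snd p)"
    proof (rule ccontr)
      assume "\<not> ?thesis"
      then have "noise_energy w p < (1 + \<delta>) * l" "(1 - \<delta>) * l < out_energy p"
        using \<delta> by (auto simp: not_le mult.assoc)
      moreover have "ln (lik p w) \<le> ln T + ln (out_dens (snd p))"
        using that T out_dens_pos[of "snd p"] lik_pos[of p w] ln_mult_pos[of T "out_dens (snd p)"]
        by (metis ln_mono mult_pos_pos)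
      ultimately show False
        using T(2) unfolding ln_lik_out_dens by (simp add: algebra_simps)
    qed
    then show "ennreal (lik p w) * indicator {p. lik p w \<le> T * out_dens (snd p)} p \<le>
        ennreal (lik p w) * indicator ?A p + ennreal (lik p w) * indicator ?B p"
      by (auto split: split_indicator)
  qed
  also have "\<dots> = (\<integral>\<^sup>+p. ennreal (lik p w) * indicator ?A p \<partial>?P) + (\<integral>\<^sup>+p. ennreal (lik p w) * indicator ?B p \<partial>?P)"
    by (rule nn_integral_add) measurable
  also have "\<dots> \<le> ennreal (((1 + \<delta>) * exp (- \<delta>)) ^ l) + ennreal (((1 + - \<delta>) * exp (- (- \<delta>))) ^ l)"
    using \<delta> by (intro add_mono noise_energy_tail out_energy_tail w) auto
  also have "\<dots> = ennreal (chernoff_bound \<delta>)"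
    using \<delta> by (simp add: chernoff_bound_def)
  finally show ?thesis
    using \<delta> T by (simp add: add_mono chernoff_bound_def)
qed

text \<open>The mirror image of \<open>error_le\<close>: unless the noise energy is small or the
  output energy large, the log-likelihood ratio is below \<open>info + 2 * \<delta> * l\<close> and
  the threshold is not passed. The tails are paid for once per message, hence the factor
  \<open>N\<close>.\<close>

lemma correct_le:
  fixes \<delta> :: real
  assumes \<delta>: "0 < \<delta>" "\<delta> < 1" and T: "0 < T" "info + 2 * \<delta> * l \<le> ln T"
  shows "(\<Sum>w<N. \<integral>\<^sup>+p. ennreal (lik p w) * indicator {p. ml_decode (lik p) N = w} p \<partial>(codebooks \<Otimes>\<^sub>M outputs)) \<le>
    ennreal (real N * chernoff_bound \<delta> + T)"
proof -
  let ?P = "codebooks \<Otimes>\<^sub>M outputs"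
  let ?A = "\<lambda>w. {p. - \<delta> * (1 + - \<delta>) * l \<le> - \<delta> * noise_energy w p}"
  let ?B = "{p. \<delta> * (1 + \<delta>) * l \<le> \<delta> * out_energy p}"
  have le: "(\<integral>\<^sup>+p. ennreal (lik p w) * indicator {p. T * out_dens (snd p) < lik p w} p \<partial>?P) \<le>
      ennreal (chernoff_bound \<delta>)" if w: "w < N" for w
  proof -
    have "(\<integral>\<^sup>+p. ennreal (lik p w) * indicator {p. T * out_dens (snd p) < lik p w} p \<partial>?P) \<le>
        (\<integral>\<^sup>+p. ennreal (lik p w) * indicator (?A w) p + ennreal (lik p w) * indicator ?B p \<partial>?P)"
    proof (intro nn_integral_mono)
      fix p
      have "p \<in> ?A w \<or> p \<in> ?B" if "T * out_dens (snd p) < lik p w"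
      proof (rule ccontr)
        assume "\<not> ?thesis"
        then have "(1 - \<delta>) * l < noise_energy w p" "out_energy p < (1 + \<delta>) * l"
          using \<delta> by (auto simp: not_le mult.assoc)
        moreover have "ln T + ln (out_dens (snd p)) \<le> ln (lik p w)"
          using that T out_dens_pos[of "snd p"] lik_pos[of p w] ln_mult_pos[of T "out_dens (snd p)"]
          by (metis ln_mono mult_pos_pos less_imp_le)
        ultimately show False
          using T(2) unfolding ln_lik_out_dens by (simp add: algebra_simps)
      qed
      then show "ennreal (lik p w) * indicator {p. T * out_dens (snd p) < lik p w} p \<le>
          ennreal (lik p w) * indicator (?A w) p + ennreal (lik p w) * indicator ?B p"
        by (auto split: split_indicator)
    qed
    also have "\<dots> = (\<integral>\<^sup>+p. ennreal (lik p w) * indicator (?A w) p \<partial>?P) + (\<integral>\<^sup>+p. ennreal (lik p w) * indicator ?B p \<partial>?P)"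
      by (rule nn_integral_add) measurable
    also have "\<dots> \<le> ennreal (((1 + - \<delta>) * exp (- (- \<delta>))) ^ l) + ennreal (((1 + \<delta>) * exp (- \<delta>)) ^ l)"
      using \<delta> by (intro add_mono noise_energy_tail out_energy_tail w) auto
    also have "\<dots> = ennreal (chernoff_bound \<delta>)"
      using \<delta> by (simp add: chernoff_bound_def add.commute)
    finally show ?thesis .
  qed
  have "(\<Sum>w<N. \<integral>\<^sup>+p. ennreal (lik p w) * indicator {p. ml_decode (lik p) N = w} p \<partial>?P) \<le>
      (\<Sum>w<N. \<integral>\<^sup>+p. ennreal (lik p w) * indicator {p. T * out_dens (snd p) < lik p w} p \<partial>?P) + ennreal T"
    using T by (intro random_coding_correct_le prob_space_codebooks sigma_finite_outputs
        nn_integral_out_dens out_dens_pos) measurable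
  also have "\<dots> \<le> (\<Sum>w<N. ennreal (chernoff_bound \<delta>)) + ennreal T"
    by (intro add_mono sum_mono le) auto
  also have "\<dots> = ennreal (real N * chernoff_bound \<delta> + T)"
    using chernoff_bound_nonneg[of \<delta>] \<delta> T by (simp add: ennreal_of_nat_eq_real_of_nat ennreal_mult[symmetric])
  finally show ?thesis .
qed

end

section \<open>Expressing the noise through likelihoods\<close>

context ddf_block
begin

lemma prob_space_shifted_noise: "prob_space (density lborel (\<lambda>z. ennreal (cgauss_density sv (z - c))))"
  using nn_integral_cgauss_density[OF sv, of c] by (intro prob_spaceI) (simp add: emeasure_density)

text \<open>Both measures are the product of the shifted Gaussians \<open>M k\<close>, since they
  agree with it on boxes. The restriction to \<open>{1..l}\<close> is there because points of a
  product space are extensional.\<close>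

lemma distr_noise:
  "distr (PiM {1..l} (\<lambda>_. cgauss sv)) outputs (\<lambda>v. \<lambda>k\<in>{1..l}. s k + v k) =
    density outputs (\<lambda>y. ennreal (\<Prod>k\<in>{1..l}. cgauss_density sv (y k - s k)))"
proof -
  define M where "M k = density lborel (\<lambda>z. ennreal (cgauss_density sv (z - s k)))" for k
  have setsM[measurable_cong, simp]: "sets (M k) = sets borel" for k
    by (simp add: M_def)
  interpret M: product_sigma_finite M
    using prob_space_shifted_noise by (auto simp: product_sigma_finite_def M_def intro: prob_space_imp_sigma_finite)
  interpret V: product_sigma_finite "\<lambda>_::nat. cgauss sv"
    using prob_space_cgauss[OF sv] by (auto simp: product_sigma_finite_def intro: prob_space_imp_sigma_finite)
  have sets: "sets outputs = sets (PiM {1..l} M)"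
    unfolding outputs_def by (rule sets_PiM_cong) auto
  have [measurable]: "(\<lambda>v. \<lambda>k\<in>{1..l}. s k + v k) \<in> measurable (PiM {1..l} (\<lambda>_. cgauss sv)) outputs"
    unfolding outputs_def by measurable
  have "distr (PiM {1..l} (\<lambda>_. cgauss sv)) outputs (\<lambda>v. \<lambda>k\<in>{1..l}. s k + v k) = PiM {1..l} M"
  proof (rule M.PiM_eqI)
    fix A assume "\<And>k. k \<in> {1..l} \<Longrightarrow> A k \<in> sets (M k)"
    then have A[measurable]: "\<And>k. k \<in> {1..l} \<Longrightarrow> A k \<in> sets borel"
      by simp
    have "Pi\<^sub>E {1..l} A \<in> sets outputs"
      unfolding sets by (intro sets_PiM_I_finite) auto
    then have "emeasure (distr (PiM {1..l} (\<lambda>_. cgauss sv)) outputs (\<lambda>v. \<lambda>k\<in>{1..l}. s k + v k)) (Pi\<^sub>E {1..l} A) =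
        emeasure (PiM {1..l} (\<lambda>_. cgauss sv))
          ((\<lambda>v. \<lambda>k\<in>{1..l}. s k + v k) -` Pi\<^sub>E {1..l} A \<inter> space (PiM {1..l} (\<lambda>_. cgauss sv)))"
      by (rule emeasure_distr[rotated]) measurable
    also have "(\<lambda>v. \<lambda>k\<in>{1..l}. s k + v k) -` Pi\<^sub>E {1..l} A \<inter> space (PiM {1..l} (\<lambda>_. cgauss sv)) =
        (\<Pi>\<^sub>E k\<in>{1..l}. {z. s k + z \<in> A k})"
      by (auto simp: space_PiM PiE_iff)
    also have "emeasure (PiM {1..l} (\<lambda>_. cgauss sv)) (\<Pi>\<^sub>E k\<in>{1..l}. {z. s k + z \<in> A k}) =
        (\<Prod>k\<in>{1..l}. emeasure (cgauss sv) {z. s k + z \<in> A k})"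
      by (rule V.emeasure_PiM) auto
    also have "\<dots> = (\<Prod>k\<in>{1..l}. emeasure (M k) (A k))"
    proof (rule prod.cong[OF refl])
      fix k assume k[measurable]: "k \<in> {1..l}"
      have "emeasure (cgauss sv) {z. s k + z \<in> A k} =
          (\<integral>\<^sup>+z. ennreal (cgauss_density sv z) * indicator (A k) (s k + z) \<partial>lborel)"
        using A[OF k] unfolding cgauss_def
        by (subst emeasure_density) (auto intro!: nn_integral_cong split: split_indicator)
      also have "\<dots> = (\<integral>\<^sup>+z. ennreal (cgauss_density sv (z - s k)) * indicator (A k) (s k + (z - s k)) \<partial>lborel)"
        using A[OF k] by (intro nn_integral_lborel_shift[symmetric]) measurable
      also have "\<dots> = emeasure (M k) (A k)"
        using A[OF k] by (simp add: M_def emeasure_density)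
      finally show "emeasure (cgauss sv) {z. s k + z \<in> A k} = emeasure (M k) (A k)" .
    qed
    finally show "emeasure (distr (PiM {1..l} (\<lambda>_. cgauss sv)) outputs (\<lambda>v. \<lambda>k\<in>{1..l}. s k + v k)) (Pi\<^sub>E {1..l} A) =
      (\<Prod>k\<in>{1..l}. emeasure (M k) (A k))" .
  qed (simp_all add: sets)
  also have "\<dots> = density outputs (\<lambda>y. ennreal (\<Prod>k\<in>{1..l}. cgauss_density sv (y k - s k)))"
  proof (rule M.PiM_eqI[symmetric])
    fix A assume "\<And>k. k \<in> {1..l} \<Longrightarrow> A k \<in> sets (M k)"
    then have A[measurable]: "\<And>k. k \<in> {1..l} \<Longrightarrow> A k \<in> sets borel"
      by simp
    have Pi[measurable]: "Pi\<^sub>E {1..l} A \<in> sets outputs"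
      unfolding sets by (intro sets_PiM_I_finite) auto
    \<comment> \<open>Membership in the box includes extensionality, which is automatic only on
      \<open>space outputs\<close>.\<close>
    have ind: "indicator (Pi\<^sub>E {1..l} A) y = (\<Prod>k\<in>{1..l}. indicator (A k) (y k) :: ennreal)"
      if "y \<in> space outputs" for y
    proof (cases "y \<in> Pi\<^sub>E {1..l} A")
      case True
      then show ?thesis
        by (auto simp: PiE_iff intro!: prod.neutral[symmetric])
    next
      case False
      moreover have "y \<in> extensional {1..l}"
        using that by (simp add: outputs_def space_PiM PiE_def)
      ultimately obtain k where "k \<in> {1..l}" "y k \<notin> A k"
        unfolding PiE_iff by blast
      then have "(\<Prod>k\<in>{1..l}. indicator (A k) (y k) :: ennreal) = 0"
        by (intro prod_zero) (auto intro!: bexI[of _ k])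
      then show ?thesis
        using False by simp
    qed
    have "emeasure (density outputs (\<lambda>y. ennreal (\<Prod>k\<in>{1..l}. cgauss_density sv (y k - s k)))) (Pi\<^sub>E {1..l} A) =
        (\<integral>\<^sup>+y. ennreal (\<Prod>k\<in>{1..l}. cgauss_density sv (y k - s k)) * indicator (Pi\<^sub>E {1..l} A) y \<partial>outputs)"
      by (rule emeasure_density) measurable
    also have "\<dots> = (\<integral>\<^sup>+y. (\<Prod>k\<in>{1..l}. ennreal (cgauss_density sv (y k - s k)) * indicator (A k) (y k)) \<partial>outputs)"
      by (intro nn_integral_cong) (simp add: ind[simplified] prod.distrib prod_ennreal sv)
    also have "\<dots> = (\<Prod>k\<in>{1..l}. \<integral>\<^sup>+z. ennreal (cgauss_density sv (z - s k)) * indicator (A k) z \<partial>lborel)"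
      by (rule nn_integral_outputs_prod) (use A in measurable)
    also have "\<dots> = (\<Prod>k\<in>{1..l}. emeasure (M k) (A k))"
      using A by (intro prod.cong refl) (simp add: M_def emeasure_density)
    finally show "emeasure (density outputs (\<lambda>y. ennreal (\<Prod>k\<in>{1..l}. cgauss_density sv (y k - s k)))) (Pi\<^sub>E {1..l} A) =
      (\<Prod>k\<in>{1..l}. emeasure (M k) (A k))" .
  qed (simp_all add: sets)
  finally show ?thesis .
qed

lemma lik_restrict: "lik (c, \<lambda>k\<in>{1..l}. y k) = lik (c, y)"
  unfolding fun_eq_iff lik_eq by (intro allI prod.cong) auto

definition block_error :: ennreal where
  "block_error = (\<Sum>w<N. \<integral>\<^sup>+p. ennreal (lik p w) * indicator {p. ml_decode (lik p) N \<noteq> w} p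
    \<partial>(codebooks \<Otimes>\<^sub>M outputs)) / of_nat N"

text \<open>The change of variables from noise to output: \<open>distr_noise\<close> turns a
  probability over the noise into an integral weighted by the likelihood of the sent
  message.\<close>

lemma nn_integral_noise_error:
  "(\<integral>\<^sup>+v. indicator {v. ml_decode (lik (c, \<lambda>k. sig c w k + v k)) N \<noteq> w} v \<partial>PiM {1..l} (\<lambda>_. cgauss sv)) =
    (\<integral>\<^sup>+y. ennreal (lik (c, y) w) * indicator {p. ml_decode (lik p) N \<noteq> w} (c, y) \<partial>outputs)"
  if c: "c \<in> space codebooks"
proof -
  have [measurable]: "(\<lambda>y. lik (c, y) m) \<in> borel_measurable outputs" for m
    unfolding lik_eq by measurable
  have T: "(\<lambda>v. \<lambda>k\<in>{1..l}. sig c w k + v k) \<in> measurable (PiM {1..l} (\<lambda>_. cgauss sv)) outputs"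
    unfolding outputs_def by measurable
  have m': "(\<lambda>y. ennreal (lik (c, y) w)) \<in> borel_measurable outputs"
    by measurable
  have m: "(\<lambda>y. indicator {p. ml_decode (lik p) N \<noteq> w} (c, y)) \<in> borel_measurable outputs"
    unfolding indicator_def mem_Collect_eq by measurable
  have "(\<integral>\<^sup>+v. indicator {v. ml_decode (lik (c, \<lambda>k. sig c w k + v k)) N \<noteq> w} v \<partial>PiM {1..l} (\<lambda>_. cgauss sv)) =
      (\<integral>\<^sup>+v. indicator {p. ml_decode (lik p) N \<noteq> w} (c, \<lambda>k\<in>{1..l}. sig c w k + v k) \<partial>PiM {1..l} (\<lambda>_. cgauss sv))"
    unfolding indicator_def mem_Collect_eq lik_restrict ..
  also have "\<dots> = (\<integral>\<^sup>+y. indicator {p. ml_decode (lik p) N \<noteq> w} (c, y)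
      \<partial>distr (PiM {1..l} (\<lambda>_. cgauss sv)) outputs (\<lambda>v. \<lambda>k\<in>{1..l}. sig c w k + v k))"
    by (rule nn_integral_distr[symmetric, OF T]) (use m in simp)
  also have "\<dots> = (\<integral>\<^sup>+y. ennreal (lik (c, y) w) * indicator {p. ml_decode (lik p) N \<noteq> w} (c, y) \<partial>outputs)"
    unfolding distr_noise lik_eq[symmetric] by (rule nn_integral_density) (use m m' in simp_all)
  finally show ?thesis .
qed

end

lemma measurable_listening_time [measurable]:
  "listening_time c \<rho> R l \<in> measurable borel (count_space UNIV)"
  unfolding listening_time_def by measurable

lemma num_messages_pos: "0 < num_messages R l"
  unfolding num_messages_def by simp


section \<open>Averaging over the channel gains\<close>

definition gains :: "(complex \<times> complex \<times> complex) measure" where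
  "gains = cgauss 1 \<Otimes>\<^sub>M cgauss 1 \<Otimes>\<^sub>M cgauss 1"

lemma prob_space_gains: "prob_space gains"
  unfolding gains_def by (intro prob_space_pair prob_space_cgauss) auto

definition ddf_cond_error :: "real \<Rightarrow> real \<Rightarrow> real \<Rightarrow> real \<Rightarrow> nat \<Rightarrow> complex \<times> complex \<times> complex \<Rightarrow> ennreal" where
  "ddf_cond_error sv c \<rho> R l g = (case g of (g1, g2, h) \<Rightarrow>
    ddf_block.block_error sv (\<rho> * sv) g1 g2 (listening_time c \<rho> R l h) (num_messages R l) l)"

text \<open>Tonelli: for fixed gains the section of the error event is integrated over the
  code-books, the uniform message and the noise. Measurability of the conditional error is inherited
  from that of the section probabilities.\<close>

lemma ddf_error_prob_eq:
  assumes sv: "0 < sv" and \<rho>: "0 < \<rho>"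
  shows measurable_ddf_cond_error: "ddf_cond_error sv c \<rho> R l \<in> borel_measurable gains" (is ?meas)
    and nn_integral_ddf_cond_error:
      "c = sv / sw \<Longrightarrow> ennreal (ddf_error_prob sw sv \<rho> R l) = (\<integral>\<^sup>+g. ddf_cond_error sv c \<rho> R l g \<partial>gains)"
proof -
  define N where "N = num_messages R l"
  define PX where "PX = PiM ({..<N} \<times> {1..l}) (\<lambda>_. cgauss (\<rho> * sv))"
  define V where "V = PiM {1..l} (\<lambda>_. cgauss sv)"
  define W where "W = measure_pmf (pmf_of_set {..<N})"
  define Q where "Q = (PX \<Otimes>\<^sub>M PX) \<Otimes>\<^sub>M (V \<Otimes>\<^sub>M W)"
  define S where "S = gains \<Otimes>\<^sub>M Q"
  define err where "err l' g1 g2 x xr v w \<longleftrightarrow>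
      ml_decode (ddf_likelihood sv l g1 g2 l' x xr (\<lambda>k. ddf_signal g1 g2 l' x xr w k + v k)) N \<noteq> w"
    for l' g1 g2 x xr v w
  define A where "A = {((g1, g2, h), (x, xr), v, w) \<in> space S. err (listening_time c \<rho> R l h) g1 g2 x xr v w}"
  have E: "0 < \<rho> * sv"
    using sv \<rho> by simp
  have N: "0 < N"
    by (simp add: N_def num_messages_pos)
  have PX: "prob_space PX"
    unfolding PX_def by (intro prob_space_PiM prob_space_cgauss E)
  have V: "prob_space V"
    unfolding V_def by (intro prob_space_PiM prob_space_cgauss sv)
  have W: "prob_space W"
    unfolding W_def by (rule measure_pmf.prob_space_axioms)
  interpret Q: prob_space Q
    unfolding Q_def by (intro prob_space_pair PX V W)
  interpret VW: prob_space "V \<Otimes>\<^sub>M W"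
    by (intro prob_space_pair V W)
  interpret VWp: pair_prob_space V W
    using V W by (simp add: pair_prob_space_def pair_sigma_finite_def prob_space_imp_sigma_finite)
  have A: "A \<in> sets S"
  proof -
    have m1[measurable]: "(\<lambda>\<omega>. fst (fst \<omega>)) \<in> borel_measurable S" "(\<lambda>\<omega>. fst (snd (fst \<omega>))) \<in> borel_measurable S"
      "(\<lambda>\<omega>. snd (snd (fst \<omega>))) \<in> borel_measurable S"
      unfolding S_def gains_def by measurable
    have m2[measurable]: "(\<lambda>\<omega>. snd (snd (snd \<omega>))) \<in> measurable S (count_space UNIV)"
      unfolding S_def Q_def W_def by measurable
    have "(\<lambda>\<omega>. fst (fst (snd \<omega>))) \<in> measurable S PX" "(\<lambda>\<omega>. snd (fst (snd \<omega>))) \<in> measurable S PX"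
      "(\<lambda>\<omega>. fst (snd (snd \<omega>))) \<in> measurable S V"
      unfolding S_def Q_def by measurable
    note this[unfolded PX_def V_def, THEN measurable_PiM_component_borel, OF sets_cgauss, measurable]
    have [measurable]: "Measurable.pred S (\<lambda>\<omega>. err l' (fst (fst \<omega>)) (fst (snd (fst \<omega>)))
      (fst (fst (snd \<omega>))) (snd (fst (snd \<omega>))) (fst (snd (snd \<omega>))) w)" for l' w
      unfolding err_def ddf_likelihood_def ddf_signal_def by measurable
    \<comment> \<open>The listening time and the message take countably many values, so
      \<open>A\<close> is a countable union of pieces on which both are fixed.\<close>
    have "A = {\<omega> \<in> space S. \<exists>l' w. listening_time c \<rho> R l (snd (snd (fst \<omega>))) = l' \<and> snd (snd (snd \<omega>)) = w \<and>
      err l' (fst (fst \<omega>)) (fst (snd (fst \<omega>)))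
        (fst (fst (snd \<omega>))) (snd (fst (snd \<omega>))) (fst (snd (snd \<omega>))) w}"
      by (auto simp: A_def)
    also have "\<dots> \<in> sets S"
      by measurable
    finally show ?thesis .
  qed
  have cond: "emeasure Q (Pair g -` A) = ddf_cond_error sv c \<rho> R l g" if "g \<in> space gains" for g
  proof -
    obtain g1 g2 h where g: "g = (g1, g2, h)"
      by (cases g)
    define l' where "l' = listening_time c \<rho> R l h"
    interpret B: ddf_block sv "\<rho> * sv" g1 g2 l' N l
      using sv E by unfold_locales
    interpret B_out: sigma_finite_measure B.outputs
      by (rule B.sigma_finite_outputs)
    have C: "B.codebooks = PX \<Otimes>\<^sub>M PX"
      by (simp add: B.codebooks_def PX_def)
    define L where "L w p = ennreal (B.lik p w) * indicator {p. ml_decode (B.lik p) N \<noteq> w} p" for w p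
    have L[measurable]: "L w \<in> borel_measurable (B.codebooks \<Otimes>\<^sub>M B.outputs)" for w
      unfolding L_def by measurable
    have sets: "Pair g -` A \<in> sets Q"
      using A unfolding S_def by (rule sets_Pair1)
    have "emeasure Q (Pair g -` A) = (\<integral>\<^sup>+q. indicator (Pair g -` A) q \<partial>Q)"
      using sets by simp
    also have "\<dots> = (\<integral>\<^sup>+c. \<integral>\<^sup>+u. indicator (Pair g -` A) (c, u) \<partial>(V \<Otimes>\<^sub>M W) \<partial>B.codebooks)"
      using sets unfolding Q_def C by (intro VW.nn_integral_fst[symmetric] borel_measurable_indicator)
    also have "\<dots> = (\<integral>\<^sup>+c. (\<Sum>w<N. \<integral>\<^sup>+y. L w (c, y) \<partial>B.outputs) / of_nat N \<partial>B.codebooks)"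
    proof (intro nn_integral_cong)
      fix c' assume c': "c' \<in> space B.codebooks"
      have "(\<lambda>u. indicator (Pair g -` A) (c', u) :: ennreal) \<in> borel_measurable (V \<Otimes>\<^sub>M W)"
        using sets c' unfolding Q_def C
        by (intro measurable_compose[OF measurable_Pair1' borel_measurable_indicator]) auto
      then have "(\<integral>\<^sup>+u. indicator (Pair g -` A) (c', u) \<partial>(V \<Otimes>\<^sub>M W)) =
          (\<integral>\<^sup>+w. \<integral>\<^sup>+v. indicator (Pair g -` A) (c', (v, w)) \<partial>V \<partial>W)"
        by (rule VWp.nn_integral_snd[symmetric])
      also have "\<dots> = (\<Sum>w<N. \<integral>\<^sup>+v. indicator (Pair g -` A) (c', (v, w)) \<partial>V) / of_nat N"
        unfolding W_def using N by (subst nn_integral_pmf_of_set) (auto simp: ennreal_of_nat_eq_real_of_nat)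
      also have "(\<Sum>w<N. \<integral>\<^sup>+v. indicator (Pair g -` A) (c', (v, w)) \<partial>V) = (\<Sum>w<N. \<integral>\<^sup>+y. L w (c', y) \<partial>B.outputs)"
      proof (rule sum.cong[OF refl])
        fix w
        have "(\<integral>\<^sup>+v. indicator (Pair g -` A) (c', (v, w)) \<partial>V) =
            (\<integral>\<^sup>+v. indicator {v. ml_decode (B.lik (c', \<lambda>k. B.sig c' w k + v k)) N \<noteq> w} v \<partial>V)"
        proof (intro nn_integral_cong)
          fix v assume "v \<in> space V"
          then have "(g, c', v, w) \<in> space S"
            using that c' by (auto simp: S_def Q_def C W_def space_pair_measure)
          then show "indicator (Pair g -` A) (c', (v, w)) =
              (indicator {v. ml_decode (B.lik (c', \<lambda>k. B.sig c' w k + v k)) N \<noteq> w} v :: ennreal)"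
            by (cases c') (simp add: indicator_def A_def g err_def l'_def[symmetric] B.lik_def[abs_def] B.sig_def)
        qed
        also have "\<dots> = (\<integral>\<^sup>+y. L w (c', y) \<partial>B.outputs)"
          unfolding L_def V_def by (rule B.nn_integral_noise_error[OF c'])
        finally show "(\<integral>\<^sup>+v. indicator (Pair g -` A) (c', (v, w)) \<partial>V) = (\<integral>\<^sup>+y. L w (c', y) \<partial>B.outputs)" .
      qed
      finally show "(\<integral>\<^sup>+u. indicator (Pair g -` A) (c', u) \<partial>(V \<Otimes>\<^sub>M W)) =
        (\<Sum>w<N. \<integral>\<^sup>+y. L w (c', y) \<partial>B.outputs) / of_nat N" .
    qed
    also have "\<dots> = (\<Sum>w<N. \<integral>\<^sup>+c. \<integral>\<^sup>+y. L w (c, y) \<partial>B.outputs \<partial>B.codebooks) / of_nat N"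
      by (subst nn_integral_divide, measurable, subst nn_integral_sum) measurable
    also have "\<dots> = B.block_error"
      unfolding B.block_error_def L_def[symmetric] by (simp add: B_out.nn_integral_fst)
    also have "\<dots> = ddf_cond_error sv c \<rho> R l g"
      by (simp add: ddf_cond_error_def g l'_def N_def)
    finally show ?thesis .
  qed
  have "(\<lambda>g. emeasure Q (Pair g -` A)) \<in> borel_measurable gains"
    using A unfolding S_def by (rule Q.measurable_emeasure_Pair)
  then show ?meas
    by (rule measurable_cong[THEN iffD1, rotated]) (rule cond)
  assume c: "c = sv / sw"
  have S: "ddf_space sv (\<rho> * sv) N l = S"
    by (simp add: ddf_space_def S_def Q_def gains_def PX_def V_def W_def)
  interpret S: prob_space S
    unfolding S_def by (intro prob_space_pair prob_space_gains Q.prob_space_axioms)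
  have "ddf_error_prob sw sv \<rho> R l = measure S A"
    unfolding ddf_error_prob_def N_def[symmetric] Let_def S A_def err_def c by simp
  then have "ennreal (ddf_error_prob sw sv \<rho> R l) = emeasure S A"
    by (simp add: S.emeasure_eq_measure)
  also have "\<dots> = (\<integral>\<^sup>+g. emeasure Q (Pair g -` A) \<partial>gains)"
    using A unfolding S_def by (rule Q.emeasure_pair_measure_alt)
  also have "\<dots> = (\<integral>\<^sup>+g. ddf_cond_error sv c \<rho> R l g \<partial>gains)"
    by (intro nn_integral_cong cond)
  finally show "ennreal (ddf_error_prob sw sv \<rho> R l) = (\<integral>\<^sup>+g. ddf_cond_error sv c \<rho> R l g \<partial>gains)" .
qed

section \<open>Convergence to the outage probability\<close>

context ddf_block
begin

lemma block_error_le: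
  fixes \<delta> :: real
  assumes N: "0 < N" and \<delta>: "0 < \<delta>" "\<delta> < 1" and T: "0 < T" "ln T + 2 * \<delta> * l \<le> info"
  shows "block_error \<le> ennreal (chernoff_bound \<delta> + real N / T)"
proof -
  let ?b = "chernoff_bound \<delta> + real N / T"
  have b: "0 \<le> ?b"
    using chernoff_bound_nonneg[OF \<delta>] T by simp
  have "block_error \<le> (\<Sum>w<N. ennreal ?b) / of_nat N"
    unfolding block_error_def
    by (intro divide_right_mono_ennreal sum_mono error_le \<delta> T) simp
  also have "(\<Sum>w<N. ennreal ?b) = ennreal (real N * ?b)"
    using b by (simp add: ennreal_of_nat_eq_real_of_nat ennreal_mult[symmetric] del: ennreal_plus)
  also have "ennreal (real N * ?b) / of_nat N = ennreal ?b"
    using b N by (simp add: ennreal_of_nat_eq_real_of_nat divide_ennreal del: ennreal_plus)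
  finally show ?thesis .
qed

lemma sum_nn_integral_lik: "(\<Sum>w<N. \<integral>\<^sup>+p. ennreal (lik p w) \<partial>(codebooks \<Otimes>\<^sub>M outputs)) = of_nat N"
proof -
  interpret C: prob_space codebooks by (rule prob_space_codebooks)
  interpret O: sigma_finite_measure outputs by (rule sigma_finite_outputs)
  interpret pair_sigma_finite codebooks outputs ..
  have "(\<integral>\<^sup>+p. ennreal (lik p w) \<partial>(codebooks \<Otimes>\<^sub>M outputs)) = 1" if w: "w < N" for w
    by (subst nn_integral_snd[symmetric]) (measurable, simp add: nn_integral_lik[OF w] nn_integral_out_dens)
  then show ?thesis
    by simp
qed

lemma block_error_le_1: "0 < N \<Longrightarrow> block_error \<le> 1"
proof -
  assume N: "0 < N"
  have "block_error \<le> (\<Sum>w<N. \<integral>\<^sup>+p. ennreal (lik p w) \<partial>(codebooks \<Otimes>\<^sub>M outputs)) / of_nat N"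
    unfolding block_error_def
    by (intro divide_right_mono_ennreal sum_mono nn_integral_mono) (simp split: split_indicator)
  also have "\<dots> = 1"
    using N unfolding sum_nn_integral_lik by (simp add: ennreal_of_nat_eq_real_of_nat divide_ennreal)
  finally show ?thesis .
qed

text \<open>The likelihoods have total mass \<open>N\<close>, which splits into correct and
  erroneous decoding, so \<open>correct_le\<close> bounds the erroneous part from below. The final
  subtraction takes place in the reals.\<close>

lemma block_error_ge:
  fixes \<delta> :: real
  assumes N: "0 < N" and \<delta>: "0 < \<delta>" "\<delta> < 1" and T: "0 < T" "info + 2 * \<delta> * l \<le> ln T"
  shows "ennreal (1 - (chernoff_bound \<delta> + T / real N)) \<le> block_error"
proof -
  let ?c = "(\<Sum>w<N. \<integral>\<^sup>+p. ennreal (lik p w) * indicator {p. ml_decode (lik p) N = w} p \<partial>(codebooks \<Otimes>\<^sub>M outputs))"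
  let ?e = "(\<Sum>w<N. \<integral>\<^sup>+p. ennreal (lik p w) * indicator {p. ml_decode (lik p) N \<noteq> w} p \<partial>(codebooks \<Otimes>\<^sub>M outputs))"
  have "of_nat N = (\<Sum>w<N. \<integral>\<^sup>+p. ennreal (lik p w) * indicator {p. ml_decode (lik p) N \<noteq> w} p +
      ennreal (lik p w) * indicator {p. ml_decode (lik p) N = w} p \<partial>(codebooks \<Otimes>\<^sub>M outputs))"
    unfolding sum_nn_integral_lik[symmetric]
    by (intro sum.cong nn_integral_cong refl) (simp split: split_indicator)
  also have "\<dots> = ?e + ?c"
    unfolding sum.distrib[symmetric] by (intro sum.cong refl nn_integral_add) measurable
  also have "\<dots> \<le> ?e + ennreal (real N * chernoff_bound \<delta> + T)"
    by (intro add_mono correct_le \<delta> T order_refl)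
  finally have "of_nat N / of_nat N \<le> (?e + ennreal (real N * chernoff_bound \<delta> + T)) / (of_nat N :: ennreal)"
    by (rule divide_right_mono_ennreal)
  also have "\<dots> = block_error + ennreal (real N * chernoff_bound \<delta> + T) / of_nat N"
    unfolding block_error_def by (rule add_divide_distrib_ennreal)
  also have "ennreal (real N * chernoff_bound \<delta> + T) / of_nat N = ennreal (chernoff_bound \<delta> + T / real N)"
    using N T chernoff_bound_nonneg[OF \<delta>]
    by (simp add: ennreal_of_nat_eq_real_of_nat divide_ennreal add_divide_distrib del: ennreal_plus)
  finally have *: "1 \<le> block_error + ennreal (chernoff_bound \<delta> + T / real N)"
    using N by (simp add: ennreal_of_nat_eq_real_of_nat divide_ennreal)
  have "block_error \<noteq> top"
    using block_error_le_1[OF N] by (auto simp: top_unique)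
  then obtain b where b: "block_error = ennreal b" "0 \<le> b"
    by (cases block_error) auto
  have c: "0 \<le> chernoff_bound \<delta> + T / real N"
    using chernoff_bound_nonneg[OF \<delta>] T by simp
  have "ennreal 1 \<le> ennreal (b + (chernoff_bound \<delta> + T / real N))"
    using * b c by (simp add: ennreal_plus[symmetric] del: ennreal_plus)
  then have "1 \<le> b + (chernoff_bound \<delta> + T / real N)"
    using b c by (subst (asm) ennreal_le_iff) auto
  then show ?thesis
    unfolding b by (intro ennreal_leI) simp
qed

end

text \<open>The strict inequality \<open>1 + t < exp t\<close> at \<open>t = \<delta>\<close> and
  \<open>t = - \<delta>\<close> makes both bases smaller than 1.\<close>

lemma chernoff_bound_tendsto:
  assumes "0 < \<delta>" "\<delta> < 1"
  shows "(\<lambda>l. ((1 + \<delta>) * exp (- \<delta>)) ^ l + ((1 - \<delta>) * exp \<delta>) ^ l) \<longlonglongrightarrow> (0::real)"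
proof -
  have lt: "1 + t < exp t" if "t \<noteq> 0" for t :: real
    using that exp_ge_add_one_self[of t] exp_minus_greater[of "- t"] by (auto simp: order_less_le)
  have "(1 + \<delta>) * exp (- \<delta>) < 1" "(1 - \<delta>) * exp \<delta> < 1"
    using lt[of \<delta>] lt[of "- \<delta>"] assms by (simp_all add: exp_minus field_simps)
  then have "(\<lambda>l. ((1 + \<delta>) * exp (- \<delta>)) ^ l) \<longlonglongrightarrow> 0" "(\<lambda>l. ((1 - \<delta>) * exp \<delta>) ^ l) \<longlonglongrightarrow> 0"
    using assms by (auto intro!: LIMSEQ_power_zero)
  from tendsto_add[OF this] show ?thesis
    by simp
qed

section \<open>Limits as the block length grows\<close>

definition listening_fraction :: "real \<Rightarrow> real \<Rightarrow> real \<Rightarrow> complex \<Rightarrow> real" where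
  "listening_fraction c \<rho> R h =
    (if h = 0 then 1 else min 1 (R / log 2 (1 + (cmod h)\<^sup>2 * c * \<rho>)))"

definition ddf_rate :: "real \<Rightarrow> real \<Rightarrow> real \<Rightarrow> complex \<times> complex \<times> complex \<Rightarrow> real" where
  "ddf_rate c \<rho> R g = (case g of (g1, g2, h) \<Rightarrow>
    listening_fraction c \<rho> R h * log 2 (1 + (cmod g1)\<^sup>2 * \<rho>) +
    (1 - listening_fraction c \<rho> R h) * log 2 (1 + ((cmod g1)\<^sup>2 + (cmod g2)\<^sup>2) * \<rho>))"

lemma log_one_plus_pos: "0 < x \<Longrightarrow> 0 < log 2 (1 + x)"
  by simp

lemma listening_fraction_bounds:
  assumes "0 < c" "0 < \<rho>" "0 < R"
  shows "0 < listening_fraction c \<rho> R h" "listening_fraction c \<rho> R h \<le> 1"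
proof -
  have "0 < R / log 2 (1 + (cmod h)\<^sup>2 * c * \<rho>)" if "h \<noteq> 0"
    using assms that by (intro divide_pos_pos log_one_plus_pos) auto
  then show "0 < listening_fraction c \<rho> R h"
    by (simp add: listening_fraction_def)
qed (simp add: listening_fraction_def)

text \<open>For \<open>h \<noteq> 0\<close> the ceiling changes the fraction by at most
  \<open>1 / l\<close>, which squeezes it between \<open>min 1 a\<close> and
  \<open>min 1 (a + 1 / l)\<close>.\<close>

lemma listening_time_tendsto:
  assumes "0 < c" "0 < \<rho>" "0 < R"
  shows "(\<lambda>l. listening_time c \<rho> R l h / l) \<longlonglongrightarrow> listening_fraction c \<rho> R h"
proof (cases "h = 0")
  case True
  have "\<forall>\<^sub>F l in sequentially. 1 = listening_time c \<rho> R l h / l"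
    using eventually_gt_at_top[of 0] by eventually_elim (simp add: True listening_time_def)
  then show ?thesis
    using True by (auto simp: listening_fraction_def intro: Lim_transform_eventually[OF tendsto_const])
next
  case False
  define a where "a = R / log 2 (1 + (cmod h)\<^sup>2 * c * \<rho>)"
  have a: "0 < a"
    unfolding a_def using assms False by (intro divide_pos_pos log_one_plus_pos) auto
  have le: "min 1 a \<le> listening_time c \<rho> R l h / l \<and> listening_time c \<rho> R l h / l \<le> min 1 (a + 1 / l)"
    if l: "0 < l" for l
  proof -
    have ceil: "real l * a \<le> of_int \<lceil>real l * a\<rceil>" "of_int \<lceil>real l * a\<rceil> \<le> real l * a + 1"
      by linarith+
    have eq: "real (listening_time c \<rho> R l h) = min (real l) (of_int \<lceil>real l * a\<rceil>)"
    proof -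
      have "listening_time c \<rho> R l h = min l (nat \<lceil>real l * a\<rceil>)"
        using False by (simp add: listening_time_def a_def)
      moreover have "real (nat \<lceil>real l * a\<rceil>) = of_int \<lceil>real l * a\<rceil>"
        using a by simp
      ultimately show ?thesis
        by (simp add: of_nat_min)
    qed
    have "min 1 a * l = min (real l) (real l * a)"
      unfolding min_mult_distrib_right by (simp add: mult.commute)
    also have "\<dots> \<le> min (real l) (of_int \<lceil>real l * a\<rceil>)"
      by (intro min.mono ceil order_refl)
    finally have 1: "min 1 a * l \<le> listening_time c \<rho> R l h"
      unfolding eq .
    have "min (real l) (of_int \<lceil>real l * a\<rceil>) \<le> min (real l) (real l * a + 1)"
      by (intro min.mono ceil order_refl)
    also have "\<dots> = min 1 (a + 1 / l) * l"
      using l unfolding min_mult_distrib_right by (simp add: distrib_right mult.commute[of a])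
    finally have 2: "listening_time c \<rho> R l h \<le> min 1 (a + 1 / l) * l"
      unfolding eq .
    show ?thesis
      using 1 2 l pos_le_divide_eq[of "real l"] pos_divide_le_eq[of "real l"] by (metis of_nat_0_less_iff)
  qed
  have lim: "(\<lambda>l. min 1 (a + 1 / real l)) \<longlonglongrightarrow> min 1 (a + 0)"
    by (intro tendsto_intros lim_1_over_n)
  have "\<forall>\<^sub>F l in sequentially. min 1 a \<le> listening_time c \<rho> R l h / l \<and>
      listening_time c \<rho> R l h / l \<le> min 1 (a + 1 / l)"
    using eventually_gt_at_top[of 0] by eventually_elim (rule le)
  then have ev: "\<forall>\<^sub>F l in sequentially. min 1 a \<le> listening_time c \<rho> R l h / l"
    "\<forall>\<^sub>F l in sequentially. listening_time c \<rho> R l h / l \<le> min 1 (a + 1 / l)"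
    unfolding eventually_conj_iff by blast+
  have "(\<lambda>l. listening_time c \<rho> R l h / l) \<longlonglongrightarrow> min 1 a"
    using tendsto_sandwich[OF ev tendsto_const lim[unfolded add_0_right]] .
  then show ?thesis
    using False by (simp add: listening_fraction_def a_def)
qed

lemma listening_time_le: "listening_time c \<rho> R l h \<le> l"
  by (simp add: listening_time_def)

text \<open>The first \<open>l'\<close> symbols contribute the direct-link term, the remaining
  \<open>l - l'\<close> the combined one. The factor \<open>ln 2\<close> converts bits into
  nats.\<close>

lemma info_tendsto:
  assumes sv: "0 < sv" and c: "0 < c" and \<rho>: "0 < \<rho>" and R: "0 < R"
  shows "(\<lambda>l. ddf_block.info sv (\<rho> * sv) g1 g2 (listening_time c \<rho> R l h) l / l)
    \<longlonglongrightarrow> ln 2 * ddf_rate c \<rho> R (g1, g2, h)"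
proof -
  let ?a = "ln (1 + (cmod g1)\<^sup>2 * \<rho>)" and ?b = "ln (1 + ((cmod g1)\<^sup>2 + (cmod g2)\<^sup>2) * \<rho>)"
  have eq: "ddf_block.info sv (\<rho> * sv) g1 g2 l' l = l' * ?a + (l - l') * ?b" if "l' \<le> l" for l l' :: nat
  proof -
    interpret ddf_block sv "\<rho> * sv" g1 g2 l' 1 l
      using sv \<rho> by unfold_locales auto
    have "info = (\<Sum>k\<in>{1..l}. if k \<le> l' then ?a else ?b)"
      unfolding info_def
    proof (intro sum.cong refl)
      fix k
      have "out_var k / sv = 1 + ((cmod g1)\<^sup>2 + (if k \<le> l' then 0 else (cmod g2)\<^sup>2)) * \<rho>"
        using sv by (simp add: out_var_def field_simps)
      then show "ln (out_var k / sv) = (if k \<le> l' then ?a else ?b)"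
        by simp
    qed
    also have "\<dots> = (\<Sum>k\<in>{1..l} \<inter> {k. k \<le> l'}. ?a) + (\<Sum>k\<in>{1..l} \<inter> - {k. k \<le> l'}. ?b)"
      by (rule sum.If_cases) simp
    also have "{1..l} \<inter> {k. k \<le> l'} = {1..l'}"
      using that by auto
    also have "{1..l} \<inter> - {k. k \<le> l'} = {l'<..l}"
      by auto
    finally show ?thesis
      by simp
  qed
  have "(\<lambda>l. listening_time c \<rho> R l h / l * ?a + (1 - listening_time c \<rho> R l h / l) * ?b)
      \<longlonglongrightarrow> listening_fraction c \<rho> R h * ?a + (1 - listening_fraction c \<rho> R h) * ?b"
    by (intro tendsto_intros listening_time_tendsto c \<rho> R)
  also have "listening_fraction c \<rho> R h * ?a + (1 - listening_fraction c \<rho> R h) * ?b =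
      ln 2 * ddf_rate c \<rho> R (g1, g2, h)"
    by (simp add: ddf_rate_def log_def field_simps)
  finally show ?thesis
  proof (rule Lim_transform_eventually)
    show "\<forall>\<^sub>F l in sequentially. listening_time c \<rho> R l h / l * ?a + (1 - listening_time c \<rho> R l h / l) * ?b =
        ddf_block.info sv (\<rho> * sv) g1 g2 (listening_time c \<rho> R l h) l / l"
      using eventually_gt_at_top[of 0]
    proof eventually_elim
      case (elim l)
      have "x / y * a + (1 - x / y) * b = (x * a + (y - x) * b) / y" if "y \<noteq> 0" for x y a b :: real
        using that by (simp add: field_simps)
      from this[of "real l"] elim show ?case
        unfolding eq[OF listening_time_le] by (simp add: of_nat_diff listening_time_le)
    qed
  qed
qed

lemma num_messages_bounds:
  "2 powr (real l * R) \<le> num_messages R l" "num_messages R l \<le> 2 powr (real l * R) + 1"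
proof -
  have "real (num_messages R l) = of_int \<lceil>2 powr (real l * R)\<rceil>"
    by (simp add: num_messages_def)
  then show "2 powr (real l * R) \<le> num_messages R l" "num_messages R l \<le> 2 powr (real l * R) + 1"
    by linarith+
qed

lemma ddf_cond_error_tendsto:
  assumes sv: "0 < sv" and c: "0 < c" and \<rho>: "0 < \<rho>" and R: "0 < R" and neq: "ddf_rate c \<rho> R g \<noteq> R"
  shows "(\<lambda>l. ddf_cond_error sv c \<rho> R l g) \<longlonglongrightarrow> indicator {g. ddf_rate c \<rho> R g < R} g"
proof -
  obtain g1 g2 h where g: "g = (g1, g2, h)"
    by (cases g)
  define I where "I = ddf_rate c \<rho> R g"
  define J where "J l = ddf_block.info sv (\<rho> * sv) g1 g2 (listening_time c \<rho> R l h) l" for l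
  \<comment> \<open>The gap between \<open>I\<close> and \<open>R\<close> must accommodate
    \<open>3 * \<delta>\<close> per symbol: \<open>2 * \<delta>\<close> for the deviation of the
    energies and \<open>\<delta>\<close> for separating the threshold from the number of messages.
    The cap \<open>1 / 2\<close> ensures \<open>\<delta> < 1\<close>.\<close>
  define \<delta> where "\<delta> = min (1 / 2) (ln 2 * \<bar>I - R\<bar> / 4)"
  define b where "b l = ((1 + \<delta>) * exp (- \<delta>)) ^ l + ((1 - \<delta>) * exp \<delta>) ^ l" for l
  have \<delta>: "0 < \<delta>" "\<delta> < 1" "3 * \<delta> < ln 2 * \<bar>I - R\<bar>"
    using neq by (auto simp: \<delta>_def I_def min_def)
  have block: "ddf_block sv (\<rho> * sv)"
    using sv \<rho> by unfold_locales auto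
  note b_eq = ddf_block.chernoff_bound_def[OF block, of _ \<delta>, folded b_def]
  have b: "b \<longlonglongrightarrow> 0"
    unfolding b_def by (rule chernoff_bound_tendsto[OF \<delta>(1,2)])
  have J: "(\<lambda>l. J l / l) \<longlonglongrightarrow> ln 2 * I"
    unfolding J_def I_def g by (rule info_tendsto[OF sv c \<rho> R])
  have e: "(\<lambda>l. exp (- \<delta>) ^ l) \<longlonglongrightarrow> 0"
    using \<delta> by (intro LIMSEQ_power_zero) simp
  have "(\<lambda>l. b l + 2 * exp (- \<delta>) ^ l) \<longlonglongrightarrow> 0 + 2 * 0"
    by (intro tendsto_intros b e)
  then have lim0: "(\<lambda>l. ennreal (b l + 2 * exp (- \<delta>) ^ l)) \<longlonglongrightarrow> 0"
    by (auto dest: tendsto_ennrealI)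
  have "(\<lambda>l. 1 - (b l + exp (- \<delta>) ^ l)) \<longlonglongrightarrow> 1 - (0 + 0)"
    by (intro tendsto_intros b e)
  then have lim1: "(\<lambda>l. ennreal (1 - (b l + exp (- \<delta>) ^ l))) \<longlonglongrightarrow> 1"
    by (auto dest: tendsto_ennrealI)
  have pow: "2 powr (real l * R) = exp (l * (R * ln 2))" for l
    by (simp add: powr_def mult_ac)
  show ?thesis
  proof (cases "I < R")
    case False
    then have "R * ln 2 + 3 * \<delta> < ln 2 * I"
      using \<delta>(3) neq by (simp add: I_def algebra_simps abs_if split: if_splits)
    then have "\<forall>\<^sub>F l in sequentially. R * ln 2 + 3 * \<delta> < J l / l"
      using order_tendstoD(1)[OF J] by blast
    then have "\<forall>\<^sub>F l in sequentially. ddf_cond_error sv c \<rho> R l g \<le> ennreal (b l + 2 * exp (- \<delta>) ^ l)"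
      using eventually_gt_at_top[of 0]
    proof eventually_elim
      case (elim l)
      let ?N = "num_messages R l" and ?T = "exp (l * (R * ln 2 + \<delta>))"
      have "ln ?T + 2 * \<delta> * l \<le> J l"
        using elim by (simp add: field_simps)
      then have "ddf_cond_error sv c \<rho> R l g \<le> ennreal (b l + ?N / ?T)"
        using ddf_block.block_error_le[OF block num_messages_pos \<delta>(1,2), of ?T l g1 g2 "listening_time c \<rho> R l h" R l]
        by (simp add: ddf_cond_error_def g b_eq J_def)
      also have "?N / ?T \<le> 2 * exp (- \<delta>) ^ l"
      proof -
        \<comment> \<open>Since the rate is positive, rounding up the number of messages at most
          doubles it.\<close>
        have "1 \<le> 2 powr (real l * R)"
          using R by (intro ge_one_powr_ge_zero) auto
        then have "real ?N \<le> 2 * exp (l * (R * ln 2))"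
          using num_messages_bounds(2)[of R l] unfolding pow by linarith
        also have "\<dots> = 2 * exp (- \<delta>) ^ l * ?T"
          by (simp add: exp_of_nat_mult[symmetric] mult_exp_exp algebra_simps)
        finally show ?thesis
          by (simp add: pos_divide_le_eq)
      qed
      finally show ?case
        by (simp add: ennreal_leI)
    qed
    then have "(\<lambda>l. ddf_cond_error sv c \<rho> R l g) \<longlonglongrightarrow> 0"
      by (rule tendsto_sandwich[OF _ _ tendsto_const lim0, rotated]) simp
    then show ?thesis
      using False by (simp add: I_def)
  next
    case True
    then have "ln 2 * I < R * ln 2 - 3 * \<delta>"
      using \<delta>(3) by (simp add: algebra_simps abs_if)
    then have "\<forall>\<^sub>F l in sequentially. J l / l < R * ln 2 - 3 * \<delta>"
      using order_tendstoD(2)[OF J] by blast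
    then have "\<forall>\<^sub>F l in sequentially. ennreal (1 - (b l + exp (- \<delta>) ^ l)) \<le> ddf_cond_error sv c \<rho> R l g"
      using eventually_gt_at_top[of 0]
    proof eventually_elim
      case (elim l)
      let ?N = "num_messages R l" and ?T = "exp (l * (R * ln 2 - \<delta>))"
      have "?T = 2 powr (real l * R) * exp (- \<delta>) ^ l"
        unfolding pow by (simp add: exp_of_nat_mult[symmetric] mult_exp_exp algebra_simps)
      also have "\<dots> \<le> ?N * exp (- \<delta>) ^ l"
        by (intro mult_right_mono num_messages_bounds) simp
      finally have "?T / ?N \<le> exp (- \<delta>) ^ l"
        using num_messages_pos[of R l] by (simp add: pos_divide_le_eq mult.commute)
      then have "ennreal (1 - (b l + exp (- \<delta>) ^ l)) \<le> ennreal (1 - (b l + ?T / ?N))"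
        by (intro ennreal_leI) simp
      also have "J l + 2 * \<delta> * l \<le> ln ?T"
        using elim by (simp add: field_simps)
      then have "ennreal (1 - (b l + ?T / ?N)) \<le> ddf_cond_error sv c \<rho> R l g"
        using ddf_block.block_error_ge[OF block num_messages_pos \<delta>(1,2), of ?T g1 g2 "listening_time c \<rho> R l h" l R l]
        by (simp add: ddf_cond_error_def g b_eq J_def)
      finally show ?case .
    qed
    moreover have "\<forall>\<^sub>F l in sequentially. ddf_cond_error sv c \<rho> R l g \<le> 1"
      using ddf_block.block_error_le_1[OF block num_messages_pos] by (simp add: ddf_cond_error_def g)
    ultimately have "(\<lambda>l. ddf_cond_error sv c \<rho> R l g) \<longlonglongrightarrow> 1"
      by (rule tendsto_sandwich[OF _ _ lim1 tendsto_const])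
    then show ?thesis
      using True by (simp add: I_def)
  qed
qed

lemma ddf_cond_error_le_1:
  assumes "0 < sv" "0 < \<rho>"
  shows "ddf_cond_error sv c \<rho> R l g \<le> 1"
proof -
  obtain g1 g2 h where g: "g = (g1, g2, h)"
    by (cases g)
  have "ddf_block sv (\<rho> * sv)"
    using assms by unfold_locales auto
  then show ?thesis
    by (simp add: ddf_cond_error_def g ddf_block.block_error_le_1 num_messages_pos)
qed

lemma measurable_ddf_rate [measurable]: "ddf_rate c \<rho> R \<in> borel_measurable gains"
  unfolding ddf_rate_def listening_fraction_def gains_def by measurable

lemma sets_outage: "{g. ddf_rate c \<rho> R g < R} \<in> sets gains"
proof -
  have "{g \<in> space gains. ddf_rate c \<rho> R g < R} \<in> sets gains"
    by measurable
  then show ?thesis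
    by (simp add: gains_def space_pair_measure)
qed

text \<open>The rate is strictly increasing in \<open>cmod g1\<close>, so that the boundary of the outage event is null.\<close>

lemma AE_ddf_rate_neq:
  assumes c: "0 < c" and \<rho>: "0 < \<rho>" and R: "0 < R"
  shows "AE g in gains. ddf_rate c \<rho> R g \<noteq> R"
proof -
  have mono: "ddf_rate c \<rho> R (g1, g2, h) < ddf_rate c \<rho> R (g1', g2, h)" if "cmod g1 < cmod g1'" for g1 g1' g2 h
  proof -
    have sq: "(cmod g1)\<^sup>2 < (cmod g1')\<^sup>2"
      using that by (intro power_strict_mono) auto
    have "log 2 (1 + (cmod g1)\<^sup>2 * \<rho>) < log 2 (1 + (cmod g1')\<^sup>2 * \<rho>)"
      using sq \<rho> by (subst log_less_cancel_iff) (auto intro!: add_pos_nonneg)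
    moreover have "log 2 (1 + ((cmod g1)\<^sup>2 + (cmod g2)\<^sup>2) * \<rho>) \<le> log 2 (1 + ((cmod g1')\<^sup>2 + (cmod g2)\<^sup>2) * \<rho>)"
      using sq \<rho> by (subst log_le_cancel_iff) (auto intro!: add_pos_nonneg mult_right_mono less_imp_le[OF that])
    ultimately show ?thesis
      using listening_fraction_bounds[OF c \<rho> R, of h] unfolding ddf_rate_def
      by (auto intro!: add_less_le_mono mult_left_mono mult_strict_left_mono)
  qed
  interpret P: prob_space "cgauss 1"
    by (rule prob_space_cgauss) simp
  interpret P2: prob_space "cgauss 1 \<Otimes>\<^sub>M cgauss 1"
    by (intro prob_space_pair prob_space_cgauss) auto
  interpret PP: pair_sigma_finite "cgauss 1" "cgauss 1 \<Otimes>\<^sub>M cgauss 1" ..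
  have sets: "{g \<in> space (cgauss 1 \<Otimes>\<^sub>M (cgauss 1 \<Otimes>\<^sub>M cgauss 1)). ddf_rate c \<rho> R g \<noteq> R}
      \<in> sets (cgauss 1 \<Otimes>\<^sub>M (cgauss 1 \<Otimes>\<^sub>M cgauss 1))"
    using measurable_ddf_rate[of c \<rho> R] unfolding gains_def by measurable
  \<comment> \<open>The product measure lists \<open>g1\<close> first, whereas the null set argument
    fixes \<open>(g2, h)\<close> and varies \<open>g1\<close>; hence the exchange of
    quantifiers.\<close>
  have iff: "(AE g1 in cgauss 1. AE p in cgauss 1 \<Otimes>\<^sub>M cgauss 1. ddf_rate c \<rho> R (g1, p) \<noteq> R) \<longleftrightarrow>
      (AE p in cgauss 1 \<Otimes>\<^sub>M cgauss 1. AE g1 in cgauss 1. ddf_rate c \<rho> R (g1, p) \<noteq> R)"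
  proof (rule PP.AE_commute)
    show "{g \<in> space (cgauss 1 \<Otimes>\<^sub>M (cgauss 1 \<Otimes>\<^sub>M cgauss 1)). ddf_rate c \<rho> R (fst g, snd g) \<noteq> R}
        \<in> sets (cgauss 1 \<Otimes>\<^sub>M (cgauss 1 \<Otimes>\<^sub>M cgauss 1))"
      unfolding prod.collapse by (rule sets)
  qed
  have ae: "AE g1 in cgauss 1. ddf_rate c \<rho> R (g1, g2, h) \<noteq> R" for g2 h
  proof (cases "\<exists>a. ddf_rate c \<rho> R (a, g2, h) = R")
    case True
    then obtain a where a: "ddf_rate c \<rho> R (a, g2, h) = R"
      by blast
    \<comment> \<open>By strict monotonicity all solutions lie on the circle of radius
      \<open>cmod a\<close>.\<close>
    show ?thesis
      using AE_cgauss_cmod_neq[where s = 1 and a = "cmod a"]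
    proof eventually_elim
      case (elim g1)
      then show ?case
        using mono[of g1 a g2 h] mono[of a g1 g2 h] a by (auto simp: neq_iff)
    qed
  qed simp
  have "AE g1 in cgauss 1. ddf_rate c \<rho> R (g1, p) \<noteq> R" for p
    using ae[of "fst p" "snd p"] unfolding prod.collapse .
  then have "AE p in cgauss 1 \<Otimes>\<^sub>M cgauss 1. AE g1 in cgauss 1. ddf_rate c \<rho> R (g1, p) \<noteq> R"
    by (rule AE_I2)
  then have "AE g1 in cgauss 1. AE p in cgauss 1 \<Otimes>\<^sub>M cgauss 1. ddf_rate c \<rho> R (g1, p) \<noteq> R"
    unfolding iff .
  then show ?thesis
    unfolding gains_def by (rule PP.AE_pair_measure[OF sets])
qed

theorem ddf_error_prob_tendsto:
  assumes sw: "0 < sw" and sv: "0 < sv" and \<rho>: "0 < \<rho>" and R: "0 < R"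
  shows "(\<lambda>l. ddf_error_prob sw sv \<rho> R l) \<longlonglongrightarrow> measure gains {g. ddf_rate (sv / sw) \<rho> R g < R}"
proof -
  let ?c = "sv / sw" and ?O = "{g. ddf_rate (sv / sw) \<rho> R g < R}"
  interpret prob_space gains
    by (rule prob_space_gains)
  have c: "0 < ?c"
    using sw sv by simp
  note [measurable] = measurable_ddf_cond_error[OF sv \<rho>] sets_outage[of ?c \<rho> R]
  have "(\<lambda>l. \<integral>\<^sup>+g. ddf_cond_error sv ?c \<rho> R l g \<partial>gains) \<longlonglongrightarrow> (\<integral>\<^sup>+g. indicator ?O g \<partial>gains)"
  proof (rule nn_integral_dominated_convergence[where w = "\<lambda>_. 1"])
    show "AE g in gains. (\<lambda>l. ddf_cond_error sv ?c \<rho> R l g) \<longlonglongrightarrow> indicator ?O g"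
      using AE_ddf_rate_neq[OF c \<rho> R] by eventually_elim (rule ddf_cond_error_tendsto[OF sv c \<rho> R])
  qed (auto simp: emeasure_space_1 ddf_cond_error_le_1[OF sv \<rho>])
  then have "(\<lambda>l. ennreal (ddf_error_prob sw sv \<rho> R l)) \<longlonglongrightarrow> ennreal (measure gains ?O)"
    by (simp add: nn_integral_ddf_cond_error[OF sv \<rho>] emeasure_eq_measure)
  moreover have "0 \<le> ddf_error_prob sw sv \<rho> R l" for l
    by (simp add: ddf_error_prob_def Let_def)
  ultimately show ?thesis
    by (simp add: tendsto_ennreal_iff)
qed

section \<open>The exponent of the outage probability\<close>

text \<open>Serves to bound the \<open>s\<close>-th power of \<open>\<rho>\<close> to one minus a
  truncated link exponent, for all \<open>\<rho> > 1\<close> at once (see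
  \<open>powr_exponent_le\<close>). The value \<open>top\<close> at \<open>0\<close> overrides
  \<open>1 / 0 = 0\<close>, which would make the weight minimal where it should be infinite.\<close>

definition inverse_power_weight :: "real \<Rightarrow> real \<Rightarrow> complex \<Rightarrow> ennreal" where
  "inverse_power_weight k s z = (if z = 0 then top else ennreal ((1 + 1 / (k * (cmod z)\<^sup>2)) powr s))"

lemma measurable_inverse_power_weight [measurable]:
  "inverse_power_weight k s \<in> borel_measurable borel"
  unfolding inverse_power_weight_def by measurable

lemma inverse_power_weight_ge_1:
  assumes "0 < k" "0 \<le> s"
  shows "1 \<le> inverse_power_weight k s z"
proof -
  have "1 \<le> (1 + 1 / (k * (cmod z)\<^sup>2)) powr s"
    using assms by (intro ge_one_powr_ge_zero) auto
  then show ?thesis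
    by (simp add: inverse_power_weight_def ennreal_1[symmetric] ennreal_leI del: ennreal_1)
qed

text \<open>
  A dyadic decomposition: the weight is at most \<open>2 powr (s * (n + 1))\<close> outside an event of
  probability \<open>O(2 powr - n)\<close>.
\<close>

lemma nn_integral_inverse_power_weight:
  assumes k: "0 < k" and s: "0 < s" "s < 1"
  shows "(\<integral>\<^sup>+z. inverse_power_weight k s z \<partial>cgauss 1) < top"
proof -
  interpret prob_space "cgauss 1"
    by (rule prob_space_cgauss) simp
  define x where "x z = 1 + 1 / (k * (cmod z)\<^sup>2)" for z
  have [measurable]: "x \<in> borel_measurable borel"
    unfolding x_def by measurable
  \<comment> \<open>The entry \<open>1\<close> handles \<open>n = 0\<close> through the total mass,
    \<open>4 / k\<close> handles \<open>n > 0\<close> through the area of a disc.\<close>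
  define M where "M = max 1 (4 / k)"
  define A where "A n = {z. 2 ^ n \<le> x z}" for n :: nat
  have A[measurable]: "A n \<in> sets borel" for n
    unfolding A_def by measurable
  have M: "1 \<le> M" "4 / k \<le> M"
    by (simp_all add: M_def)
  have emA: "emeasure (cgauss 1) (A n) \<le> ennreal (M / 2 ^ n)" for n
  proof (cases "n = 0")
    case True
    have "emeasure (cgauss 1) (A n) \<le> 1"
      by (rule emeasure_le_1)
    also have "1 \<le> ennreal (M / 2 ^ n)"
      using True M by (simp add: ennreal_1[symmetric] ennreal_leI del: ennreal_1)
    finally show ?thesis .
  next
    case False
    have two: "(2::real) \<le> 2 ^ n"
      using False power_increasing[of 1 n "2::real"] by simp
    have "A n \<subseteq> {z. (cmod z)\<^sup>2 < 4 / k / 2 ^ n}"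
    proof
      fix z assume "z \<in> A n"
      then have z: "2 ^ n \<le> 1 + 1 / (k * (cmod z)\<^sup>2)"
        by (simp add: A_def x_def)
      define y where "y = k * (cmod z)\<^sup>2"
      have "y \<noteq> 0"
        using z two unfolding y_def by auto
      then have y: "0 < y"
        using k by (simp add: y_def less_le)
      \<comment> \<open>Together with \<open>2 * y \<le> 2 ^ n * y\<close> this gives
        \<open>y \<le> 1\<close> and hence \<open>2 ^ n * y \<le> 2\<close>; the constant
        \<open>4\<close> leaves room for strictness.\<close>
      have "2 ^ n * y \<le> y + 1"
        using z y unfolding y_def[symmetric] by (simp add: field_simps)
      moreover have "2 * y \<le> 2 ^ n * y"
        using two y by simp
      ultimately have "2 ^ n * y < 4"
        by simp
      then show "z \<in> {z. (cmod z)\<^sup>2 < 4 / k / 2 ^ n}"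
        using k by (simp add: y_def field_simps)
    qed
    then have "emeasure (cgauss 1) (A n) \<le> emeasure (cgauss 1) {z. (cmod z)\<^sup>2 < 4 / k / 2 ^ n}"
      by (intro emeasure_mono) auto
    also have "\<dots> \<le> ennreal (4 / k / 2 ^ n)"
      using k by (intro emeasure_cgauss_less) auto
    also have "\<dots> \<le> ennreal (M / 2 ^ n)"
      using M by (intro ennreal_leI divide_right_mono) auto
    finally show ?thesis .
  qed
  have "(\<integral>\<^sup>+z. inverse_power_weight k s z \<partial>cgauss 1) \<le>
      (\<integral>\<^sup>+z. (\<Sum>n. ennreal ((2 ^ (n + 1)) powr s) * indicator (A n) z) \<partial>cgauss 1)"
  proof (rule nn_integral_mono_AE)
    show "AE z in cgauss 1. inverse_power_weight k s z \<le>
        (\<Sum>n. ennreal ((2 ^ (n + 1)) powr s) * indicator (A n) z)"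
      using AE_cgauss_cmod_neq[where s = 1 and a = 0]
    proof eventually_elim
      case (elim z)
      have x1: "1 \<le> x z"
        using k by (simp add: x_def)
      define n where "n = nat \<lfloor>log 2 (x z)\<rfloor>"
      have "0 \<le> log 2 (x z)"
        using x1 by simp
      then have n: "real n \<le> log 2 (x z)" "log 2 (x z) < real n + 1"
        unfolding n_def by linarith+
      have "2 powr real n \<le> x z"
        using n(1) x1 by (simp add: le_log_iff)
      then have zA: "z \<in> A n"
        by (simp add: A_def powr_realpow)
      have "x z < 2 powr (real n + 1)"
        using n(2) x1 by (simp add: log_less_iff)
      also have "2 powr (real n + 1) = 2 ^ (n + 1)"
        by (simp add: powr_add powr_realpow)
      finally have "x z powr s \<le> (2 ^ (n + 1)) powr s"
        using x1 s by (intro powr_mono2) auto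
      then have "inverse_power_weight k s z \<le> ennreal ((2 ^ (n + 1)) powr s) * indicator (A n) z"
        using elim zA by (simp add: inverse_power_weight_def x_def ennreal_leI)
      also have "\<dots> = (\<Sum>n\<in>{n}. ennreal ((2 ^ (n + 1)) powr s) * indicator (A n) z)"
        by (subst sum.insert) (simp_all only: finite.emptyI empty_iff not_False_eq_True sum.empty add_0_right)
      also have "\<dots> \<le> (\<Sum>n. ennreal ((2 ^ (n + 1)) powr s) * indicator (A n) z)"
        by (rule sum_le_suminf) auto
      finally show ?case .
    qed
  qed
  also have "\<dots> = (\<Sum>n. \<integral>\<^sup>+z. ennreal ((2 ^ (n + 1)) powr s) * indicator (A n) z \<partial>cgauss 1)"
    by (rule nn_integral_suminf) measurable
  also have "\<dots> = (\<Sum>n. ennreal ((2 ^ (n + 1)) powr s) * emeasure (cgauss 1) (A n))"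
    by (simp add: nn_integral_cmult_indicator)
  also have "\<dots> \<le> (\<Sum>n. ennreal (M * 2 powr s * (2 powr (s - 1)) ^ n))"
  proof (intro suminf_le summableI)
    fix n
    have "ennreal ((2 ^ (n + 1)) powr s) * emeasure (cgauss 1) (A n) \<le>
        ennreal ((2 ^ (n + 1)) powr s) * ennreal (M / 2 ^ n)"
      by (intro mult_left_mono emA) simp
    also have "\<dots> = ennreal (M * 2 powr s * (2 powr (s - 1)) ^ n)"
    proof -
      have "(2 ^ (n + 1)) powr s / 2 ^ n = 2 powr s * (2 powr (s - 1)) ^ n"
      proof -
        have "(2 ^ (n + 1)) powr s = 2 powr (real (n + 1) * s)"
          by (simp add: powr_powr powr_realpow[symmetric] del: of_nat_Suc power_Suc)
        moreover have "(2 powr (s - 1)) ^ n = 2 powr (real n * (s - 1))"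
          by (simp add: powr_powr powr_realpow[symmetric] mult.commute)
        moreover have "(2::real) ^ n = 2 powr real n"
          by (simp add: powr_realpow)
        ultimately show ?thesis
          by (simp add: powr_add[symmetric] powr_diff[symmetric] algebra_simps)
      qed
      then have "(2 ^ (n + 1)) powr s * (M / 2 ^ n) = M * 2 powr s * (2 powr (s - 1)) ^ n"
        by (simp add: field_simps)
      then show ?thesis
        using M by (simp add: ennreal_mult[symmetric] del: power_Suc)
    qed
    finally show "ennreal ((2 ^ (n + 1)) powr s) * emeasure (cgauss 1) (A n) \<le>
      ennreal (M * 2 powr s * (2 powr (s - 1)) ^ n)" .
  qed
  also have "\<dots> < top"
  proof -
    \<comment> \<open>The growth \<open>2 powr s\<close> of the weights loses against the decay
      \<open>1 / 2\<close> of the probabilities because \<open>s < 1\<close>.\<close>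
    have "(2::real) powr (s - 1) < 1"
      using s powr_less_mono[of "s - 1" 0 2] by simp
    then have "summable (\<lambda>n. M * 2 powr s * (2 powr (s - 1)) ^ n)"
      by (intro summable_mult summable_geometric) simp
    then show ?thesis
      using M by (subst suminf_ennreal_eq[OF _ summable_sums]) (auto simp: less_top)
  qed
  finally show ?thesis .
qed

text \<open>If the exponent is below 1, the left side is \<open>\<rho> / (1 + a * \<rho>)\<close>,
  which is at most \<open>1 / a\<close>; otherwise it is 1.\<close>

lemma powr_exponent_le:
  assumes "1 < \<rho>" "0 < a"
  shows "\<rho> powr (1 - min 1 (log 2 (1 + a * \<rho>) / log 2 \<rho>)) \<le> 1 + 1 / a"
proof -
  have eq: "log 2 (1 + a * \<rho>) / log 2 \<rho> = log \<rho> (1 + a * \<rho>)"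
    using assms by (simp add: log_def)
  have pos: "0 < 1 + a * \<rho>"
    using assms by (simp add: add_pos_nonneg)
  show ?thesis
  proof (cases "1 \<le> log \<rho> (1 + a * \<rho>)")
    case True
    then show ?thesis
      using assms by (simp add: eq)
  next
    case False
    then have "\<rho> powr (1 - min 1 (log 2 (1 + a * \<rho>) / log 2 \<rho>)) = \<rho> / (1 + a * \<rho>)"
      using assms pos by (simp add: eq powr_diff)
    also have "\<dots> \<le> 1 / a"
      using assms pos by (simp add: field_simps)
    finally show ?thesis
      by simp
  qed
qed

text \<open>
  The optimisation problem behind the exponent: \<open>\<alpha>\<close>, \<open>\<beta>\<close>, \<open>\<gamma>\<close> are the exponents in \<open>\<rho>\<close> of
  the three channel gains times \<open>\<rho>\<close>, and \<open>\<mu>\<close> is that of the combined destination gain.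
\<close>

lemma outage_exponent:
  fixes r \<alpha> \<beta> \<gamma> \<mu> :: real
  assumes r: "0 < r" and \<gamma>: "0 < \<gamma>" and \<mu>: "\<alpha> \<le> \<mu>" "\<beta> \<le> \<mu>"
    and outage: "min 1 (r / \<gamma>) * \<alpha> + (1 - min 1 (r / \<gamma>)) * \<mu> < r"
  shows "(1 - r) / max (1 / 2) r \<le> 3 - min 1 \<alpha> - min 1 \<beta> - min 1 \<gamma>"
proof (cases "r < 1")
  case False
  then have "(1 - r) / max (1 / 2) r \<le> 0"
    by (simp add: divide_nonpos_pos)
  then show ?thesis
    by linarith
next
  case r1: True
  define U V W where "U = min 1 \<alpha>" and "V = min 1 \<beta>" and "W = min 1 \<gamma>"
  note UVW = U_def V_def W_def
  have le1: "U \<le> 1" "V \<le> 1" "W \<le> 1"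
    by (simp_all add: UVW)
  have d2: "(1 - r) / max (1 / 2) r \<le> 2 * (1 - r)"
  proof -
    have "1 - r \<le> 2 * (1 - r) * m" if "1 / 2 \<le> m" for m
      using mult_left_mono[of 1 "2 * m" "1 - r"] r1 that by (simp add: algebra_simps)
    from this[of "max (1 / 2) r"] show ?thesis
      by (subst pos_divide_le_eq) auto
  qed
  have "(1 - r) / max (1 / 2) r \<le> 3 - (U + V + W)"
  \<comment> \<open>In the first case the relay listens throughout, so outage means
    \<open>\<alpha> < r\<close>, and two of the three truncated exponents are at most
    \<open>r\<close>.\<close>
  proof (cases "\<gamma> \<le> r")
    case True
    then have "min 1 (r / \<gamma>) = 1"
      using \<gamma> by simp
    then have "\<alpha> < r"
      using outage by simp
    then show ?thesis
      using True d2 le1 by (simp add: UVW min_def split: if_splits)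
  next
    case False
    define M where "M = max U V"
    have UM: "U \<le> M"
      by (simp add: M_def)
    have W: "r < W" "0 < W" "W \<le> \<gamma>"
      using False r r1 by (auto simp: W_def)
    \<comment> \<open>Truncation preserves outage: a smaller relay exponent prolongs listening, and
      smaller destination exponents lower the mutual information. Multiplying by \<open>W\<close>
      clears the fraction \<open>r / W\<close>.\<close>
    have key: "r * U + (W - r) * M < r * W"
    proof -
      define f where "f = r / \<gamma>"
      define f' where "f' = r / W"
      have f: "min 1 (r / \<gamma>) = f" "0 < f" "f < 1" "f \<le> f'"
        using False r \<gamma> W by (auto simp: f_def f'_def frac_le)
      have "f' * U + (1 - f') * M = M - f' * (M - U)"
        by (simp add: algebra_simps)
      also have "\<dots> \<le> M - f * (M - U)"
        using f UM by (simp add: mult_right_mono)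
      also have "\<dots> = f * U + (1 - f) * M"
        by (simp add: algebra_simps)
      also have "\<dots> \<le> f * \<alpha> + (1 - f) * \<mu>"
        using f \<mu> by (intro add_mono mult_left_mono) (auto simp: M_def UVW)
      also have "\<dots> < r"
        using outage f by simp
      finally have "W * (f' * U + (1 - f') * M) < W * r"
        using W by simp
      moreover have "W * (f' * U + (1 - f') * M) = r * U + (W - r) * M"
        using W by (simp add: f'_def field_simps)
      ultimately show ?thesis
        by (simp add: mult.commute)
    qed
    have *: ?thesis if "U < r" "V < r"
    proof -
      have "U + V + W < 1 + 2 * r"
        using that le1 by linarith
      then show ?thesis
        using d2 by simp
    qed
    show ?thesis
    proof (cases "V \<le> U")
      case True
      then have "W * U < W * r"
        using key by (simp add: M_def algebra_simps)
      then show ?thesis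
        using W True by (intro *) auto
    next
      case UV: False
      then have key': "r * (U + V + W) < 2 * r * (W + V) - W * V"
        using key by (simp add: M_def algebra_simps)
      consider "V < r" | "r \<le> V" "1 / 2 \<le> r" | "r \<le> V" "r < 1 / 2"
        by linarith
      then show ?thesis
      proof cases
        case 1
        then show ?thesis
          using UV by (intro *) auto
      next
        case 2
        \<comment> \<open>Here \<open>V\<close> and \<open>W\<close> are at most 1 and
          \<open>2 * r\<close> is at least 1, so the worst case is \<open>V = W = 1\<close>: only
          the direct link is weak.\<close>
        have "(2 * r - 1) * (2 * r - 1) \<le> (2 * r - W) * (2 * r - V)"
          using 2 le1 by (intro mult_mono) auto
        then have "r * (U + V + W) \<le> 4 * r - 1"
          using key' by (simp add: algebra_simps)
        then have "1 - r \<le> (3 - (U + V + W)) * r"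
          by (simp add: algebra_simps)
        then show ?thesis
          using 2 r by (simp add: max_def pos_divide_le_eq)
      next
        case 3
        \<comment> \<open>The left side is affine in \<open>W\<close>, so the sign of
          \<open>2 * r - V\<close> decides between the extreme values \<open>W = 1\<close> and
          \<open>W = r\<close>.\<close>
        have "W * (2 * r - V) + 2 * r * V \<le> r * (1 + 2 * r)"
        proof (cases "V \<le> 2 * r")
          case True
          then have "W * (2 * r - V) \<le> 1 * (2 * r - V)"
            using le1 by (intro mult_right_mono) auto
          moreover have "(1 - 2 * r) * r \<le> (1 - 2 * r) * V"
            using 3 by (intro mult_left_mono) auto
          ultimately show ?thesis
            by (simp add: algebra_simps)
        next
          case False
          then have "W * (2 * r - V) \<le> r * (2 * r - V)"
            using W by (intro mult_right_mono_neg) auto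
          moreover have "r * V \<le> r * 1"
            using r le1 by (intro mult_left_mono) auto
          ultimately show ?thesis
            by (simp add: algebra_simps)
        qed
        then have "r * (U + V + W) < r * (1 + 2 * r)"
          using key' by (simp add: algebra_simps)
        then have "U + V + W < 1 + 2 * r"
          using r by simp
        then show ?thesis
          using d2 by simp
      qed
    qed
  qed
  then show ?thesis
    by (simp add: UVW)
qed

text \<open>The pointwise form of Markov's inequality: in outage, \<open>outage_exponent\<close>
  makes the total exponent of \<open>\<rho>\<close> nonnegative, and each link's power of
  \<open>\<rho>\<close> is bounded by a weight free of \<open>\<rho>\<close>.\<close>

lemma outage_weight:
  assumes c: "0 < c" and \<rho>: "1 < \<rho>" and R: "0 < R" and s: "0 < s"
    and outage: "ddf_rate c \<rho> R (g1, g2, h) < R"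
  shows "1 \<le> ennreal (\<rho> powr (- (s * ((1 - R / log 2 \<rho>) / max (1 / 2) (R / log 2 \<rho>))))) *
    (inverse_power_weight 1 s g1 * (inverse_power_weight 1 s g2 * inverse_power_weight c s h))"
    (is "1 \<le> ennreal ?C * (?F1 * (?F2 * ?F3))")
proof -
  have ge1: "1 \<le> ?F1" "1 \<le> ?F2" "1 \<le> ?F3"
    using c s by (auto intro: inverse_power_weight_ge_1)
  have C: "0 < ?C"
    using \<rho> by simp
  show ?thesis
  \<comment> \<open>A vanishing gain makes the right side infinite, because the other weights are at
    least 1.\<close>
  proof (cases "g1 = 0 \<or> g2 = 0 \<or> h = 0")
    case True
    have "?F1 \<noteq> 0" "?F2 \<noteq> 0" "?F3 \<noteq> 0"
      using ge1 by auto
    moreover have "?F1 = top \<or> ?F2 = top \<or> ?F3 = top"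
      using True by (auto simp: inverse_power_weight_def)
    ultimately have "?F1 * (?F2 * ?F3) = top"
      by (auto simp: ennreal_mult_eq_top_iff)
    then show ?thesis
      using C by (simp add: ennreal_mult_top)
  next
    case False
    define L where "L = log 2 \<rho>"
    define ex where "ex a = log 2 (1 + a * \<rho>) / L" for a
    define r where "r = R / L"
    define A B D where "A = (cmod g1)\<^sup>2" and "B = (cmod g2)\<^sup>2" and "D = c * (cmod h)\<^sup>2"
    have pos: "0 < A" "0 < B" "0 < D"
      using False c by (auto simp: A_def B_def D_def)
    have L: "0 < L"
      using \<rho> by (simp add: L_def)
    have mono: "ex a \<le> ex b" if "0 \<le> a" "a \<le> b" for a b
      using that \<rho> L unfolding ex_def
      by (intro divide_right_mono log_le_cancel_iff[THEN iffD2]) (auto intro!: add_pos_nonneg mult_right_mono)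
    have "listening_fraction c \<rho> R h = min 1 (r / ex D)"
      using False L by (simp add: listening_fraction_def r_def ex_def D_def mult_ac)
    then have "ddf_rate c \<rho> R (g1, g2, h) / L =
        min 1 (r / ex D) * ex A + (1 - min 1 (r / ex D)) * ex (A + B)"
      by (simp add: ddf_rate_def ex_def A_def B_def add_divide_distrib)
    moreover have "ddf_rate c \<rho> R (g1, g2, h) / L < r"
      using outage L by (simp add: r_def divide_strict_right_mono)
    moreover have "0 < ex D"
      unfolding ex_def using pos \<rho> L by (intro divide_pos_pos log_one_plus_pos) auto
    ultimately have "(1 - r) / max (1 / 2) r \<le> 3 - min 1 (ex A) - min 1 (ex B) - min 1 (ex D)"
      using R L pos by (intro outage_exponent[where \<mu> = "ex (A + B)"] mono) (auto simp: r_def)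
    then have "0 \<le> s * (- ((1 - r) / max (1 / 2) r) + (1 - min 1 (ex A)) + (1 - min 1 (ex B)) + (1 - min 1 (ex D)))"
      using s by (intro mult_nonneg_nonneg) auto
    then have "0 \<le> - (s * ((1 - r) / max (1 / 2) r)) + s * (1 - min 1 (ex A)) + s * (1 - min 1 (ex B)) + s * (1 - min 1 (ex D))"
      by (simp only: distrib_left mult_minus_right)
    then have "\<rho> powr 0 \<le> \<rho> powr (- (s * ((1 - r) / max (1 / 2) r)) + s * (1 - min 1 (ex A)) +
        s * (1 - min 1 (ex B)) + s * (1 - min 1 (ex D)))"
      using \<rho> by (intro powr_mono) auto
    also have "\<dots> = ?C * ((\<rho> powr (1 - min 1 (ex A))) powr s *
        ((\<rho> powr (1 - min 1 (ex B))) powr s * (\<rho> powr (1 - min 1 (ex D))) powr s))"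
      by (simp only: powr_add powr_powr r_def L_def mult.commute[of s] mult.assoc)
    also have "\<dots> \<le> ?C * ((1 + 1 / A) powr s * ((1 + 1 / B) powr s * (1 + 1 / D) powr s))"
      using C \<rho> s pos unfolding ex_def L_def
      by (intro mult_left_mono mult_mono powr_mono2 powr_exponent_le) auto
    finally have "1 \<le> ?C * ((1 + 1 / A) powr s * ((1 + 1 / B) powr s * (1 + 1 / D) powr s))"
      using \<rho> by simp
    then show ?thesis
      using False C
      by (simp add: inverse_power_weight_def A_def B_def D_def ennreal_mult[symmetric]
          ennreal_1[symmetric] ennreal_leI del: ennreal_1)
  qed
qed

lemma nn_integral_gains_prod:
  assumes [measurable]: "f \<in> borel_measurable borel" "g \<in> borel_measurable borel" "h \<in> borel_measurable borel"
  shows "(\<integral>\<^sup>+(z1, z2, z3). f z1 * (g z2 * h z3) \<partial>gains) =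
    (\<integral>\<^sup>+z. f z \<partial>cgauss 1) * ((\<integral>\<^sup>+z. g z \<partial>cgauss 1) * (\<integral>\<^sup>+z. h z \<partial>cgauss 1))"
proof -
  interpret P: prob_space "cgauss 1"
    by (rule prob_space_cgauss) simp
  interpret P2: prob_space "cgauss 1 \<Otimes>\<^sub>M cgauss 1"
    by (intro prob_space_pair prob_space_cgauss) auto
  show ?thesis
    unfolding gains_def
    by (subst P2.nn_integral_fst[symmetric], measurable)
      (simp add: P.nn_integral_fst[symmetric] nn_integral_cmult nn_integral_multc)
qed

text \<open>When \<open>outage_weight\<close> is integrated, independence of the gains splits the
  moment into three finite factors. \<open>K\<close> depends on \<open>c\<close> and
  \<open>s\<close> only, so the bound is uniform in \<open>\<rho>\<close> and
  \<open>R\<close>.\<close>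

lemma outage_prob_le:
  assumes c: "0 < c" and s: "0 < s" "s < 1"
  obtains K where "0 < K" "\<And>\<rho> R. 1 < \<rho> \<Longrightarrow> 0 < R \<Longrightarrow> measure gains {g. ddf_rate c \<rho> R g < R} \<le>
    K * \<rho> powr (- (s * ((1 - R / log 2 \<rho>) / max (1 / 2) (R / log 2 \<rho>))))"
proof -
  interpret prob_space gains
    by (rule prob_space_gains)
  define m where "m k = (\<integral>\<^sup>+z. inverse_power_weight k s z \<partial>cgauss 1)" for k
  have "m 1 * (m 1 * m c) < top"
    unfolding m_def using c s by (simp add: ennreal_mult_less_top nn_integral_inverse_power_weight)
  then obtain K where K: "m 1 * (m 1 * m c) = ennreal K" "0 \<le> K"
    by (cases "m 1 * (m 1 * m c)") auto
  have "measure gains {g. ddf_rate c \<rho> R g < R} \<le>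
      (K + 1) * \<rho> powr (- (s * ((1 - R / log 2 \<rho>) / max (1 / 2) (R / log 2 \<rho>))))" (is "?P \<le> _ * ?C")
    if \<rho>: "1 < \<rho>" and R: "0 < R" for \<rho> R
  proof -
    note [measurable] = sets_outage[of c \<rho> R]
    have "ennreal ?P = (\<integral>\<^sup>+g. indicator {g. ddf_rate c \<rho> R g < R} g \<partial>gains)"
      by (simp add: emeasure_eq_measure)
    also have "\<dots> \<le> (\<integral>\<^sup>+(g1, g2, h). (ennreal ?C * inverse_power_weight 1 s g1) *
        (inverse_power_weight 1 s g2 * inverse_power_weight c s h) \<partial>gains)"
    proof (intro nn_integral_mono)
      fix g :: "complex \<times> complex \<times> complex"
      obtain g1 g2 h where g: "g = (g1, g2, h)"
        by (cases g)
      show "indicator {g. ddf_rate c \<rho> R g < R} g \<le> (case g of (g1, g2, h) \<Rightarrow>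
          (ennreal ?C * inverse_power_weight 1 s g1) * (inverse_power_weight 1 s g2 * inverse_power_weight c s h))"
        using outage_weight[OF c \<rho> R s(1), of g1 g2 h]
        by (auto simp: g mult.assoc split: split_indicator)
    qed
    also have "\<dots> = (ennreal ?C * m 1) * (m 1 * m c)"
      unfolding m_def by (subst nn_integral_gains_prod) (measurable, simp add: nn_integral_cmult)
    also have "\<dots> = ennreal (K * ?C)"
      using K(2) unfolding mult.assoc K(1) by (simp add: ennreal_mult[symmetric] mult.commute)
    finally have "?P \<le> K * ?C"
      using K by (subst (asm) ennreal_le_iff) auto
    also have "\<dots> \<le> (K + 1) * ?C"
      by (simp add: mult_right_mono)
    finally show ?thesis .
  qed
  then show ?thesis
    \<comment> \<open>\<open>K\<close> is only known to be nonnegative; adding 1 makes the constant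
      positive.\<close>
    using K by (intro that[of "K + 1"]) auto
qed

section \<open>Lower bounds on the outage probability\<close>

lemma measure_cgauss_less_ge:
  assumes "0 < u"
  shows "min u 1 / exp 1 \<le> measure (cgauss 1) {z. (cmod z)\<^sup>2 < u}"
proof -
  interpret prob_space "cgauss 1"
    by (rule prob_space_cgauss) simp
  show ?thesis
    using emeasure_cgauss_less(2)[OF assms] by (simp add: emeasure_eq_measure)
qed

lemma measure_gains_box_le:
  assumes sub: "\<And>g1 g2 h. (cmod g1)\<^sup>2 < u1 \<Longrightarrow> (cmod g2)\<^sup>2 < u2 \<Longrightarrow> h \<in> H \<Longrightarrow> (g1, g2, h) \<in> S"
    and [measurable]: "H \<in> sets borel" "S \<in> sets gains"
    and u: "0 < u1" "0 < u2"
  shows "(min u1 1 / exp 1) * ((min u2 1 / exp 1) * measure (cgauss 1) H) \<le> measure gains S"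
proof -
  interpret P: prob_space "cgauss 1"
    by (rule prob_space_cgauss) simp
  interpret P2: prob_space "cgauss 1 \<Otimes>\<^sub>M cgauss 1"
    by (intro prob_space_pair prob_space_cgauss) auto
  interpret G: prob_space gains
    by (rule prob_space_gains)
  let ?B = "\<lambda>u. {z. (cmod z)\<^sup>2 < u}"
  have "(min u1 1 / exp 1) * ((min u2 1 / exp 1) * measure (cgauss 1) H) \<le>
      measure (cgauss 1) (?B u1) * (measure (cgauss 1) (?B u2) * measure (cgauss 1) H)"
    using u by (intro mult_mono measure_cgauss_less_ge) auto
  also have "\<dots> = measure gains (?B u1 \<times> (?B u2 \<times> H))"
    unfolding gains_def by (simp add: measure_def P2.emeasure_pair_measure_Times P.emeasure_pair_measure_Times enn2real_mult)
  also have "\<dots> \<le> measure gains S"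
    using sub by (intro G.finite_measure_mono) auto
  finally show ?thesis .
qed

lemma ddf_rate_le_log_sum:
  assumes c: "0 < c" and \<rho>: "0 < \<rho>" and R: "0 < R"
  shows "ddf_rate c \<rho> R (g1, g2, h) \<le> log 2 (1 + ((cmod g1)\<^sup>2 + (cmod g2)\<^sup>2) * \<rho>)"
proof -
  define f where "f = listening_fraction c \<rho> R h"
  have "log 2 (1 + (cmod g1)\<^sup>2 * \<rho>) \<le> log 2 (1 + ((cmod g1)\<^sup>2 + (cmod g2)\<^sup>2) * \<rho>)"
    using \<rho> by (subst log_le_cancel_iff) (auto intro!: add_pos_nonneg mult_right_mono)
  then have "f * log 2 (1 + (cmod g1)\<^sup>2 * \<rho>) \<le> f * log 2 (1 + ((cmod g1)\<^sup>2 + (cmod g2)\<^sup>2) * \<rho>)"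
    using listening_fraction_bounds[OF c \<rho> R, of h] by (intro mult_left_mono) (auto simp: f_def)
  then show ?thesis
    by (simp add: ddf_rate_def f_def algebra_simps)
qed

text \<open>If both destination links are weak, the relay is of no use.\<close>

lemma outage_prob_ge_both:
  assumes c: "0 < c" and \<rho>: "0 < \<rho>" and R: "0 < R"
  shows "(min ((2 powr R - 1) / \<rho> / 2) 1 / exp 1)\<^sup>2 \<le> measure gains {g. ddf_rate c \<rho> R g < R}"
proof -
  \<comment> \<open>At combined gain \<open>2 * u\<close> the pooled destination links support
    exactly the rate \<open>R\<close>.\<close>
  define u where "u = (2 powr R - 1) / \<rho> / 2"
  have u: "0 < u"
    using \<rho> R by (simp add: u_def)
  have "(g1, g2, h) \<in> {g. ddf_rate c \<rho> R g < R}"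
    if "(cmod g1)\<^sup>2 < u" "(cmod g2)\<^sup>2 < u" for g1 g2 h
  proof -
    have "((cmod g1)\<^sup>2 + (cmod g2)\<^sup>2) * \<rho> < (2 * u) * \<rho>"
      using that \<rho> by (intro mult_strict_right_mono) auto
    also have "(2 * u) * \<rho> = 2 powr R - 1"
      using \<rho> by (simp add: u_def)
    finally have "log 2 (1 + ((cmod g1)\<^sup>2 + (cmod g2)\<^sup>2) * \<rho>) < R"
      using \<rho> by (subst log_less_iff) (auto intro!: add_pos_nonneg)
    then show ?thesis
      using ddf_rate_le_log_sum[OF c \<rho> R, of g1 g2 h] by simp
  qed
  from measure_gains_box_le[OF this _ sets_outage u u, where H = UNIV] show ?thesis
    using prob_space.prob_space[OF prob_space_cgauss[of 1]]
    by (simp add: power2_eq_square u_def)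
qed

text \<open>If only the source-destination link is weak, the relay helps too late.\<close>

lemma outage_prob_ge_late:
  assumes c: "0 < c" and \<rho>: "1 \<le> \<rho>" and R: "0 < R" and x: "0 \<le> x"
    and f: "f = min 1 (R / log 2 (1 + c * \<rho>))"
    and outage: "f * log 2 (1 + \<rho> powr (1 - x)) + (1 - f) * log 2 (1 + 2 * \<rho>) < R"
  shows "\<rho> powr (- x) / (exp 1) ^ 3 \<le> measure gains {g. ddf_rate c \<rho> R g < R}"
proof -
  define u where "u = \<rho> powr (- x)"
  have u: "0 < u" "u \<le> 1"
    using \<rho> x powr_mono[of "- x" 0 \<rho>] by (auto simp: u_def)
  have u\<rho>: "u * \<rho> = \<rho> powr (1 - x)"
    using \<rho> by (simp add: u_def powr_diff powr_minus field_simps)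
  have "(g1, g2, h) \<in> {g. ddf_rate c \<rho> R g < R}"
    if g: "(cmod g1)\<^sup>2 < u" "(cmod g2)\<^sup>2 < 1" and h: "h \<in> {h. (cmod h)\<^sup>2 < 1}" for g1 g2 h
  proof -
    define f' where "f' = listening_fraction c \<rho> R h"
    define a a1 b b1 where "a = log 2 (1 + (cmod g1)\<^sup>2 * \<rho>)" and "a1 = log 2 (1 + u * \<rho>)"
      and "b = log 2 (1 + ((cmod g1)\<^sup>2 + (cmod g2)\<^sup>2) * \<rho>)" and "b1 = log 2 (1 + 2 * \<rho>)"
    have f': "0 \<le> f'" "f' \<le> 1"
      using listening_fraction_bounds[OF c _ R, of \<rho> h] \<rho> by (auto simp: f'_def)
    \<comment> \<open>A relay gain below 1 means listening for at least the fraction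
      \<open>f\<close>, and longer listening only lowers the rate because
      \<open>a1 \<le> b1\<close>.\<close>
    have ff': "f \<le> f'"
    proof (cases "h = 0")
      case True
      then show ?thesis
        by (simp add: f f'_def listening_fraction_def)
    next
      case False
      have "(cmod h)\<^sup>2 * (c * \<rho>) \<le> 1 * (c * \<rho>)"
        using h c \<rho> by (intro mult_right_mono) auto
      then have "log 2 (1 + (cmod h)\<^sup>2 * c * \<rho>) \<le> log 2 (1 + c * \<rho>)"
        using c \<rho> by (subst log_le_cancel_iff) (auto intro!: add_pos_nonneg simp: mult.assoc)
      moreover have "0 < log 2 (1 + (cmod h)\<^sup>2 * c * \<rho>)"
        using False c \<rho> by (intro log_one_plus_pos) auto
      ultimately have "R / log 2 (1 + c * \<rho>) \<le> R / log 2 (1 + (cmod h)\<^sup>2 * c * \<rho>)"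
        using R by (intro divide_left_mono) auto
      then show ?thesis
        using False by (simp add: f f'_def listening_fraction_def min.coboundedI2)
    qed
    have "a \<le> a1" "b \<le> b1" "a1 \<le> b1"
      unfolding a_def a1_def b_def b1_def using g u \<rho>
      by (subst log_le_cancel_iff; (auto intro!: add_pos_nonneg mult_right_mono)[1])+
    then have "f' * a + (1 - f') * b \<le> f' * a1 + (1 - f') * b1"
      using f' by (intro add_mono mult_left_mono) auto
    also have "\<dots> = b1 - f' * (b1 - a1)"
      by (simp add: algebra_simps)
    also have "\<dots> \<le> b1 - f * (b1 - a1)"
      using ff' \<open>a1 \<le> b1\<close> by (simp add: mult_right_mono)
    also have "\<dots> = f * a1 + (1 - f) * b1"
      by (simp add: algebra_simps)
    also have "\<dots> < R"
      using outage by (simp add: a1_def b1_def u\<rho>)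
    finally show ?thesis
      by (simp add: ddf_rate_def f'_def a_def b_def)
  qed
  from measure_gains_box_le[OF this _ sets_outage u(1) zero_less_one, where H = "{h. (cmod h)\<^sup>2 < 1}"]
  have "u / exp 1 * (1 / exp 1 * measure (cgauss 1) {h. (cmod h)\<^sup>2 < 1}) \<le> measure gains {g. ddf_rate c \<rho> R g < R}"
    using u by simp
  \<comment> \<open>Each of the three gains contributes one factor \<open>1 / exp 1\<close>.\<close>
  moreover have "u / exp 1 * (1 / exp 1 * (1 / exp 1)) \<le> u / exp 1 * (1 / exp 1 * measure (cgauss 1) {h. (cmod h)\<^sup>2 < 1})"
    using u measure_cgauss_less_ge[of 1] by (intro mult_left_mono) auto
  ultimately show ?thesis
    by (simp add: u_def power3_eq_cube)
qed

section \<open>From power bounds to the diversity gain\<close>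

lemma eventually_exponent_less:
  assumes k: "0 < k" and xy: "x < y" and P: "\<forall>\<^sub>F \<rho> in at_top. k * \<rho> powr (- x) \<le> P \<rho>"
  shows "\<forall>\<^sub>F \<rho> in at_top. 0 < P \<rho> \<and> - (log 2 (P \<rho>) / log 2 \<rho>) < (y :: real)"
proof -
  \<comment> \<open>A constant factor disappears on the logarithmic scale, and the gap between
    \<open>x\<close> and \<open>y\<close> absorbs it.\<close>
  have "((\<lambda>\<rho>. log 2 k / log 2 \<rho>) \<longlongrightarrow> 0) at_top"
    by real_asymp
  then have "\<forall>\<^sub>F \<rho> in at_top. x - y < log 2 k / log 2 \<rho>"
    using xy by (intro order_tendstoD) auto
  then show ?thesis
    using P eventually_gt_at_top[of 1]
  proof eventually_elim
    case (elim \<rho>)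
    have pos: "0 < k * \<rho> powr (- x)"
      using k elim by simp
    have L: "0 < log 2 \<rho>"
      using elim by simp
    have "log 2 k - x * log 2 \<rho> = log 2 (k * \<rho> powr (- x))"
      using k elim by (simp add: log_mult log_powr)
    also have "\<dots> \<le> log 2 (P \<rho>)"
      using pos elim by simp
    finally have "(log 2 k - x * log 2 \<rho>) / log 2 \<rho> \<le> log 2 (P \<rho>) / log 2 \<rho>"
      using L by (intro divide_right_mono) auto
    then show ?case
      using elim pos L by (simp add: diff_divide_distrib)
  qed
qed

lemma eventually_exponent_greater:
  assumes k: "0 < k" and xy: "y < x" and P: "\<forall>\<^sub>F \<rho> in at_top. P \<rho> \<le> k * \<rho> powr (- x)"
    and pos: "\<forall>\<^sub>F \<rho> in at_top. 0 < P \<rho>"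
  shows "\<forall>\<^sub>F \<rho> in at_top. (y :: real) < - (log 2 (P \<rho>) / log 2 \<rho>)"
proof -
  have "((\<lambda>\<rho>. log 2 k / log 2 \<rho>) \<longlongrightarrow> 0) at_top"
    by real_asymp
  then have "\<forall>\<^sub>F \<rho> in at_top. log 2 k / log 2 \<rho> < x - y"
    using xy by (intro order_tendstoD) auto
  then show ?thesis
    using P pos eventually_gt_at_top[of 1]
  proof eventually_elim
    case (elim \<rho>)
    have L: "0 < log 2 \<rho>"
      using elim by simp
    have "log 2 (P \<rho>) \<le> log 2 (k * \<rho> powr (- x))"
      using elim k by simp
    also have "\<dots> = log 2 k - x * log 2 \<rho>"
      using k elim by (simp add: log_mult log_powr)
    finally have "log 2 (P \<rho>) / log 2 \<rho> \<le> (log 2 k - x * log 2 \<rho>) / log 2 \<rho>"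
      using L by (intro divide_right_mono) auto
    then show ?case
      using elim L by (simp add: diff_divide_distrib)
  qed
qed

text \<open>The formula with \<open>max (1 / 2) r\<close> covers both branches and is continuous in
  \<open>r\<close>, so it passes to the limit along \<open>R \<rho> / log 2 \<rho>\<close>. The
  exponent is kept from above by one of the two lower bounds on outage, depending on the branch, and
  from below by Markov's bound with \<open>s\<close> close to 1.\<close>

lemma outage_diversity_gain:
  assumes c: "0 < c" and r: "0 \<le> r" "r \<le> 1" and gain: "has_multiplexing_gain R r"
    and \<epsilon>: "0 < \<epsilon>" "\<forall>\<^sub>F \<rho> in at_top. \<epsilon> \<le> R \<rho>"
  shows "has_diversity_gain (\<lambda>\<rho>. measure gains {g. ddf_rate c \<rho> (R \<rho>) g < R \<rho>}) ((1 - r) / max (1 / 2) r)"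
proof -
  define P where "P \<rho> = measure gains {g. ddf_rate c \<rho> (R \<rho>) g < R \<rho>}" for \<rho>
  define d where "d = (1 - r) / max (1 / 2) r"
  define q where "q \<rho> = R \<rho> / log 2 \<rho>" for \<rho>
  have q: "(q \<longlongrightarrow> r) at_top"
    using gain by (simp add: has_multiplexing_gain_def q_def[abs_def])
  have d: "0 \<le> d"
    using r by (simp add: d_def)
  have less: "\<forall>\<^sub>F \<rho> in at_top. 0 < P \<rho> \<and> - (log 2 (P \<rho>) / log 2 \<rho>) < y" if y: "d < y" for y
  proof (cases "r \<le> 1 / 2")
    case True
    \<comment> \<open>This choice gives \<open>2 * (1 - r') = d + (y - d) / 2\<close>, which is
      below \<open>y\<close>.\<close>
    define \<eta> where "\<eta> = (y - d) / 4"
    define r' where "r' = r - \<eta>"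
    have d2: "d = 2 * (1 - r)"
      using True by (simp add: d_def max_absorb1)
    have \<eta>: "0 < \<eta>" "2 * (1 - r') < y"
      using y by (auto simp: \<eta>_def r'_def d2 field_simps)
    \<comment> \<open>As \<open>R \<rho>\<close> is at least \<open>\<epsilon>\<close>, the
      difference \<open>2 powr R \<rho> - 1\<close> is at least \<open>2 * \<kappa>\<close> times
      \<open>2 powr R \<rho>\<close>. This matters when \<open>r = 0\<close> and the rate may stay
      bounded.\<close>
    define \<kappa> where "\<kappa> = (1 - 2 powr (- \<epsilon>)) / 2"
    have "2 powr (- \<epsilon>) < 1"
      using \<epsilon>(1) powr_less_mono[of "- \<epsilon>" 0 2] by simp
    moreover have "0 \<le> 2 powr (- \<epsilon>)"
      by (rule powr_ge_zero)
    ultimately have \<kappa>: "0 < \<kappa>" "\<kappa> \<le> 1"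
      by (simp_all only: \<kappa>_def) argo+
    have "\<forall>\<^sub>F \<rho> in at_top. r' < q \<rho>"
      using \<eta> by (intro order_tendstoD[OF q]) (simp add: r'_def)
    then have "\<forall>\<^sub>F \<rho> in at_top. (\<kappa> / exp 1)\<^sup>2 * \<rho> powr (- (2 * (1 - r'))) \<le> P \<rho>"
      using \<epsilon>(2) eventually_gt_at_top[of 1]
    proof eventually_elim
      case (elim \<rho>)
      have L: "0 < log 2 \<rho>"
        using elim by simp
      have "r' * log 2 \<rho> \<le> R \<rho>"
        using elim L by (simp add: q_def pos_less_divide_eq)
      then have "2 powr (r' * log 2 \<rho>) \<le> 2 powr R \<rho>"
        by simp
      moreover have "2 powr (r' * log 2 \<rho>) = \<rho> powr r'"
      proof -
        have "2 powr (r' * log 2 \<rho>) = (2 powr log 2 \<rho>) powr r'"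
          by (simp only: powr_powr mult.commute)
        also have "2 powr log 2 \<rho> = \<rho>"
          using elim by simp
        finally show ?thesis .
      qed
      ultimately have "\<rho> powr r' \<le> 2 powr R \<rho>"
        by simp
      then have "\<kappa> * \<rho> powr r' \<le> \<kappa> * 2 powr R \<rho>"
        using \<kappa> by simp
      also have "\<dots> = (2 powr R \<rho> - 2 powr (R \<rho> - \<epsilon>)) / 2"
        by (simp add: \<kappa>_def powr_diff powr_minus field_simps)
      also have "\<dots> \<le> (2 powr R \<rho> - 1) / 2"
        using elim ge_one_powr_ge_zero[of 2 "R \<rho> - \<epsilon>"] by simp
      finally have "\<kappa> * \<rho> powr r' / \<rho> \<le> (2 powr R \<rho> - 1) / 2 / \<rho>"
        using elim by (intro divide_right_mono) auto
      moreover have "\<kappa> * \<rho> powr r' / \<rho> = \<kappa> * \<rho> powr (r' - 1)"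
        using elim by (simp add: powr_diff)
      moreover have "\<kappa> * \<rho> powr (r' - 1) \<le> 1"
        using \<kappa> elim r \<eta> powr_mono[of "r' - 1" 0 \<rho>] by (intro mult_le_one) (auto simp: r'_def)
      ultimately have "\<kappa> * \<rho> powr (r' - 1) \<le> min ((2 powr R \<rho> - 1) / \<rho> / 2) 1"
        by (simp add: field_simps)
      then have "(\<kappa> * \<rho> powr (r' - 1) / exp 1)\<^sup>2 \<le> (min ((2 powr R \<rho> - 1) / \<rho> / 2) 1 / exp 1)\<^sup>2"
        using \<kappa> by (intro power_mono divide_right_mono) auto
      also have "\<dots> \<le> P \<rho>"
        unfolding P_def using elim \<epsilon> by (intro outage_prob_ge_both c) auto
      also have "(\<kappa> * \<rho> powr (r' - 1) / exp 1)\<^sup>2 = (\<kappa> / exp 1)\<^sup>2 * \<rho> powr (- (2 * (1 - r')))"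
      proof -
        have "\<rho> powr (- (2 * (1 - r'))) = (\<rho> powr (r' - 1))\<^sup>2"
          by (simp add: power2_eq_square powr_add[symmetric])
        then show ?thesis
          by (simp add: power_mult_distrib power_divide)
      qed
      finally show ?case .
    qed
    from eventually_exponent_less[OF _ \<eta>(2) this] show ?thesis
      using \<kappa> by simp
  next
    case False
    then have d1: "d = (1 - r) / r" "d < 1"
      using r by (simp_all add: d_def max_def)
    \<comment> \<open>The branch \<open>r > 1 / 2\<close> has \<open>d < 1\<close>, so
      \<open>x\<close> fits below both \<open>y\<close> and 1; the weak direct link then has the
      positive exponent \<open>1 - x\<close>.\<close>
    define x where "x = (d + min 1 y) / 2"
    have x: "d < x" "x < 1" "x < y"
      using y d1(2) by (auto simp: x_def min_def)
    define f where "f \<rho> = min 1 (R \<rho> / log 2 (1 + c * \<rho>))" for \<rho>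
    have "((\<lambda>\<rho>. log 2 \<rho> / log 2 (1 + c * \<rho>)) \<longlongrightarrow> 1) at_top"
      using c by real_asymp
    from tendsto_mult[OF q this] have "((\<lambda>\<rho>. R \<rho> / log 2 (1 + c * \<rho>)) \<longlongrightarrow> r * 1) at_top"
    proof (rule Lim_transform_eventually)
      show "\<forall>\<^sub>F \<rho> in at_top. q \<rho> * (log 2 \<rho> / log 2 (1 + c * \<rho>)) = R \<rho> / log 2 (1 + c * \<rho>)"
        using eventually_gt_at_top[of 1]
      proof eventually_elim
        case (elim \<rho>)
        then have "0 < log 2 \<rho>"
          by simp
        then show ?case
          by (simp add: q_def)
      qed
    qed
    then have f: "(f \<longlongrightarrow> r) at_top"
      using tendsto_min[OF tendsto_const, of _ "r * 1" at_top 1] r by (simp add: f_def[abs_def] min_absorb2)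
    have a: "((\<lambda>\<rho>. log 2 (1 + \<rho> powr (1 - x)) / log 2 \<rho>) \<longlongrightarrow> 1 - x) at_top"
      using x by real_asymp
    have b: "((\<lambda>\<rho>. log 2 (1 + 2 * \<rho>) / log 2 \<rho>) \<longlongrightarrow> 1) at_top"
      by real_asymp
    have "((\<lambda>\<rho>. q \<rho> - (f \<rho> * (log 2 (1 + \<rho> powr (1 - x)) / log 2 \<rho>) + (1 - f \<rho>) * (log 2 (1 + 2 * \<rho>) / log 2 \<rho>)))
        \<longlongrightarrow> r - (r * (1 - x) + (1 - r) * 1)) at_top"
      by (intro tendsto_intros q f a b)
    \<comment> \<open>In the limit, outage asks for \<open>r * (1 - x) + (1 - r) < r\<close>, that
      is \<open>x > (1 - r) / r\<close>.\<close>
    moreover have "0 < r - (r * (1 - x) + (1 - r) * 1)"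
    proof -
      have "1 - r < r * x"
        using x(1) d1(1) False by (simp add: field_simps)
      then show ?thesis
        by (simp add: algebra_simps)
    qed
    ultimately have "\<forall>\<^sub>F \<rho> in at_top. 0 < q \<rho> -
        (f \<rho> * (log 2 (1 + \<rho> powr (1 - x)) / log 2 \<rho>) + (1 - f \<rho>) * (log 2 (1 + 2 * \<rho>) / log 2 \<rho>))"
      by (rule order_tendstoD)
    then have "\<forall>\<^sub>F \<rho> in at_top. (1 / (exp 1) ^ 3) * \<rho> powr (- x) \<le> P \<rho>"
      using \<epsilon>(2) eventually_gt_at_top[of 1]
    proof eventually_elim
      case (elim \<rho>)
      define L where "L = log 2 \<rho>"
      have L: "0 < L"
        using elim by (simp add: L_def)
      have "0 < (R \<rho> - (f \<rho> * log 2 (1 + \<rho> powr (1 - x)) + (1 - f \<rho>) * log 2 (1 + 2 * \<rho>))) / L"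
        using elim(1) by (simp add: q_def L_def[symmetric] diff_divide_distrib add_divide_distrib)
      then have "f \<rho> * log 2 (1 + \<rho> powr (1 - x)) + (1 - f \<rho>) * log 2 (1 + 2 * \<rho>) < R \<rho>"
        using L by (simp add: zero_less_divide_iff)
      then have "\<rho> powr (- x) / (exp 1) ^ 3 \<le> P \<rho>"
        unfolding P_def using elim \<epsilon> d x by (intro outage_prob_ge_late[OF c _ _ _ f_def]) auto
      then show ?case
        by simp
    qed
    from eventually_exponent_less[OF _ x(3) this] show ?thesis
      by simp
  qed
  have pos: "\<forall>\<^sub>F \<rho> in at_top. 0 < P \<rho>"
    by (rule eventually_mono[OF less[of "d + 1"]]) simp_all
  have greater: "\<forall>\<^sub>F \<rho> in at_top. y < - (log 2 (P \<rho>) / log 2 \<rho>)" if y: "y < d" for y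
  proof -
    \<comment> \<open>\<open>s\<close> is taken so close to 1 that \<open>s * d\<close> stays above
      \<open>y\<close>; if \<open>d = 0\<close>, then \<open>y\<close> is negative and any
      \<open>s\<close> will do.\<close>
    obtain s where s: "0 < s" "s < 1" "y < s * d"
    proof (cases "d = 0")
      case True
      then show ?thesis
        using y by (intro that[of "1 / 2"]) auto
    next
      case False
      then have d: "0 < d"
        using d by simp
      define m where "m = max 0 (y / d)"
      define s where "s = (1 + m) / 2"
      have "0 \<le> m" "m < 1" "y / d \<le> m"
        using d y by (simp_all add: m_def)
      then have "0 < s" "s < 1" "y / d < s"
        unfolding s_def by argo+
      then show ?thesis
        using d by (intro that[of s]) (auto simp: pos_divide_less_eq)
    qed
    \<comment> \<open>The intermediate \<open>x\<close> leaves one gap for the convergence of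
      \<open>q\<close> and one for the constant \<open>K\<close>.\<close>
    obtain x where x: "y < x" "x < s * d"
      using dense[OF s(3)] by blast
    obtain K where K: "0 < K" "\<And>\<rho> R. 1 < \<rho> \<Longrightarrow> 0 < R \<Longrightarrow> measure gains {g. ddf_rate c \<rho> R g < R} \<le>
        K * \<rho> powr (- (s * ((1 - R / log 2 \<rho>) / max (1 / 2) (R / log 2 \<rho>))))"
      using outage_prob_le[OF c s(1,2)] by blast
    have "((\<lambda>\<rho>. s * ((1 - q \<rho>) / max (1 / 2) (q \<rho>))) \<longlongrightarrow> s * d) at_top"
      unfolding d_def by (intro tendsto_intros q) auto
    then have "\<forall>\<^sub>F \<rho> in at_top. x < s * ((1 - q \<rho>) / max (1 / 2) (q \<rho>))"
      using x by (intro order_tendstoD)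
    then have "\<forall>\<^sub>F \<rho> in at_top. P \<rho> \<le> K * \<rho> powr (- x)"
      using \<epsilon>(2) eventually_gt_at_top[of 1]
    proof eventually_elim
      case (elim \<rho>)
      then have "P \<rho> \<le> K * \<rho> powr (- (s * ((1 - q \<rho>) / max (1 / 2) (q \<rho>))))"
        unfolding P_def q_def using \<epsilon> by (intro K) auto
      also have "\<dots> \<le> K * \<rho> powr (- x)"
        using elim K by (intro mult_left_mono powr_mono) auto
      finally show ?case .
    qed
    from eventually_exponent_greater[OF K(1) x(1) this pos] show ?thesis .
  qed
  have "((\<lambda>\<rho>. - (log 2 (P \<rho>) / log 2 \<rho>)) \<longlongrightarrow> d) at_top"
  proof (rule order_tendstoI)
    fix y assume "d < y"
    from less[OF this] show "\<forall>\<^sub>F \<rho> in at_top. - (log 2 (P \<rho>) / log 2 \<rho>) < y"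
      by (rule eventually_mono) simp
  qed (rule greater)
  then show ?thesis
    using pos unfolding has_diversity_gain_def P_def d_def by blast
qed

text \<open>The lower bound on the rate has substance for \<open>r = 0\<close>: the multiplexing
  gain alone would let the rate vanish as \<open>\<rho>\<close> grows, and the outage probability
  could then decay faster than the formula says.\<close>

theorem theorem4:
  fixes sw sv r :: real and R :: "real \<Rightarrow> real"
  assumes "sw > 0" and "sv > 0"
    and "0 \<le> r" and "r \<le> 1"
    and "has_multiplexing_gain R r"
    and "\<exists>\<epsilon>>0. \<forall>\<^sub>F \<rho> in at_top. \<epsilon> \<le> R \<rho>"
  shows "ddf_achieves sw sv R (if r \<le> 1 / 2 then 2 * (1 - r) else (1 - r) / r)"
proof -
  obtain \<epsilon> where \<epsilon>: "0 < \<epsilon>" "\<forall>\<^sub>F \<rho> in at_top. \<epsilon> \<le> R \<rho>"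
    using assms(6) by blast
  define P where "P \<rho> = measure gains {g. ddf_rate (sv / sw) \<rho> (R \<rho>) g < R \<rho>}" for \<rho>
  have "\<forall>\<^sub>F \<rho> in at_top. (\<lambda>l. ddf_error_prob sw sv \<rho> (R \<rho>) l) \<longlonglongrightarrow> P \<rho>"
    using \<epsilon>(2) eventually_gt_at_top[of 0]
  proof eventually_elim
    case (elim \<rho>)
    then show ?case
      unfolding P_def using assms(1,2) \<epsilon>(1) by (intro ddf_error_prob_tendsto) auto
  qed
  moreover have "has_diversity_gain P ((1 - r) / max (1 / 2) r)"
    unfolding P_def using assms \<epsilon> by (intro outage_diversity_gain) auto
  moreover have "(1 - r) / max (1 / 2) r = (if r \<le> 1 / 2 then 2 * (1 - r) else (1 - r) / r)"
    by (cases "r \<le> 1 / 2") (simp_all add: max_absorb1)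
  ultimately show ?thesis
    unfolding ddf_achieves_def by auto
qed

end
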